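(* Let $X$ be a set, $Y$ a topological space, $f:X\to Y$ a mapping and $d$ a metric on the mapping $f$. For $y\in Y$ let $\mathcal C_y$ be the set of all the Cauchy nets on $X$ (on the mapping $f$) tied to $y$, and for $\Phi:D\to X$ and $\Phi':D'\to X$ in $\mathcal C_y$ put $\Phi\sim_y\Phi'$ if and only if for every $\epsilon>0$ there are $\gamma\in D$ and $\gamma'\in D'$ such that $d(\Phi(\alpha),\Phi'(\alpha'))<\epsilon$ for all $\alpha\ge\gamma$ and $\alpha'\ge\gamma'$; this is an equivalence relation. Let $\Phi^*$ denote the $\sim_y$-class of $\Phi$, let $\mathcal C_y^*=\mathcal C_y/{\sim_y}$ be the set of all the equivalence classes, and consider the disjoint union $$X^*=\bigcup_{y\in Y}(\mathcal C_y^*\times\{y\}).$$ For $(\Phi^*,y),(\Phi'^*,y')\in X^*$ with $\Phi:D\to X$ and $\Phi':D'\to X$ set $$d^*\big((\Phi^*,y),(\Phi'^*,y')\big)=\lim_{(\alpha,\alpha')\in D\times D'}d(\Phi(\alpha),\Phi'(\alpha')),$$ where $D\times D'$ is directed by $(\alpha,\alpha')\le(\beta,\beta')$ if and only if $\alpha\le\beta$ and $\alpha'\le\beta'$. Let $f^*:X^*\to Y$ be given by $f^*(\Phi^*,y)=y$, and let $i:X\to X^*$ be given by $i(x)=(\underline{x}^*,f(x))$, where $\underline{x}:\{0\}\to X$ is the constant net $\underline{x}(0)=x$. Then $d^*$ is well defined and is a metric on the mapping $f^*$, this metric is complete, and $i$ is a dense isometric embedding of $f$ into $f^*$, that is: $i$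 is injective, $f^*\circ i=f$, $d^*(i(x),i(x'))=d(x,x')$ for all $x,x'\in X$, $i$ is continuous with respect to $\tau(f,d)$ and $\tau(f^*,d^* )$, and $i(X)$ is dense in $X^*$ with respect to $\tau(f^*,d^* )$. Hence $(f^*,d^* )$ is a completion of $(f,d)$.
   Context: For a set $Z$, a topological space $Y$ with topology $\tau(Y)$, and a mapping $g:Z\to Y$: Metric on a mapping: a pseudometric $\rho$ on $Z$ is called a metric on the mapping $g$ if for every $y\in Y$ the restriction of $\rho$ to $g^{-1}(\{y\})\times g^{-1}(\{y\})$ is a metric on $g^{-1}(\{y\})$. The pair $(g,\rho)$ is then called a metric mapping. Metric topology of $g$: $\tau(g,\rho)$ is the topology on $Z$ having $\tau(\rho)\cup\{g^{-1}(V):V\in\tau(Y)\}$ as a subbase, where $\tau(\rho)$ is the topology generated by the pseudometric $\rho$. Complete metric: for $y\in Y$ let $\mathcal N_y$ be the family of neighborhoods of $y$ in $Y$. A metric $\rho$ on $g$ is complete if for every $y\in Y$ and every filter $\mathcal F$ on $Z$ such that $g^{-1}(O)\in\mathcal F$ for all $O\in\mathcal N_y$ and such that for every $\epsilon>0$ there is $F\in\mathcal F$ with $\mathrm{diam}(F)<\epsilon$ (with respect to $\rho$), some point of $g^{-1}(\{y\})$ is a cluster point of $\mathcal F$ with respect to $\tau(g,\rho)$. Cauchy net tied to $y$: a net $\Phi:D\to Z$ ($D$ a directed set) is a Cauchy net (on the mapping $g$) tied to $y\in Y$ if (i) for every $\epsilon>0$ there is $\alpha\in D$ such that $\rho(\Phi(\beta),\Phi(\gamma))<\epsilon$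 for all $\beta,\gamma\ge\alpha$; and (ii) for every neighborhood $O$ of $y$ in $Y$ there is $\alpha\in D$ such that $\Phi(\beta)\in g^{-1}(O)$ for all $\beta\ge\alpha$. Completion: a completion of a metric mapping $(f:X\to Y,d)$ is a complete metric mapping $(f^*:X^*\to Y,d^* )$ together with a fixed dense isometric embedding $f\to f^*$, i.e. an injective map $\lambda:X\to X^*$, continuous for the metric topologies $\tau(f,d)$ and $\tau(f^*,d^* )$, with $f^*\circ\lambda=f$, $d^*(\lambda(x_1),\lambda(x_2))=d(x_1,x_2)$ for all $x_1,x_2\in X$, and $\lambda(X)$ dense in $(X^*,\tau(f^*,d^* ))$.
   Formalization: The Cauchy nets tied to y over all directed sets form a proper class, so the formal theorem takes only nets whose directed sets D are subsets of a fixed but arbitrary index type at least as large as the power set of X; every Cauchy net is equivalent to such a net. *)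

theory Defs
  imports "HOL-Analysis.Analysis" "HOL-Library.Equipollence"
begin

section \<open>Metrics on mappings\<close>

text \<open>Sets and spaces are given by carriers, so they may be empty. Functions on them are
  unconstrained outside the carrier; in particular, no condition is put on \<open>\<rho>\<close> off \<open>Z \<times> Z\<close>.\<close>

definition pseudometric_on :: "'z set \<Rightarrow> ('z \<Rightarrow> 'z \<Rightarrow> real) \<Rightarrow> bool" where
  "pseudometric_on Z \<rho> \<longleftrightarrow>
     (\<forall>x\<in>Z. \<forall>y\<in>Z. 0 \<le> \<rho> x y) \<and>
     (\<forall>x\<in>Z. \<rho> x x = 0) \<and>
     (\<forall>x\<in>Z. \<forall>y\<in>Z. \<rho> x y = \<rho> y x) \<and>
     (\<forall>x\<in>Z. \<forall>y\<in>Z. \<forall>z\<in>Z. \<rho> x z \<le> \<rho> x y + \<rho> y z)"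

definition fibre :: "'z set \<Rightarrow> ('z \<Rightarrow> 'y) \<Rightarrow> 'y \<Rightarrow> 'z set" where
  "fibre Z g y = {z \<in> Z. g z = y}"

text \<open>\<^locale>\<open>Metric_space\<close> asks for nonnegativity and symmetry on the whole type, so a function is
  cut off to \<open>0\<close> outside the set to which it is restricted.\<close>

definition dist_restrict :: "'z set \<Rightarrow> ('z \<Rightarrow> 'z \<Rightarrow> real) \<Rightarrow> 'z \<Rightarrow> 'z \<Rightarrow> real" where
  "dist_restrict S \<rho> = (\<lambda>x y. if x \<in> S \<and> y \<in> S then \<rho> x y else 0)"

definition metric_on_map :: "'z set \<Rightarrow> 'y topology \<Rightarrow> ('z \<Rightarrow> 'y) \<Rightarrow> ('z \<Rightarrow> 'z \<Rightarrow> real) \<Rightarrow> bool" where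
  "metric_on_map Z Y g \<rho> \<longleftrightarrow> pseudometric_on Z \<rho> \<and>
     (\<forall>y\<in>topspace Y. Metric_space (fibre Z g y) (dist_restrict (fibre Z g y) \<rho>))"

definition metric_mapping :: "'z set \<Rightarrow> 'y topology \<Rightarrow> ('z \<Rightarrow> 'y) \<Rightarrow> ('z \<Rightarrow> 'z \<Rightarrow> real) \<Rightarrow> bool" where
  "metric_mapping Z Y g \<rho> \<longleftrightarrow> g \<in> Z \<rightarrow> topspace Y \<and> metric_on_map Z Y g \<rho>"

definition pm_topology :: "'z set \<Rightarrow> ('z \<Rightarrow> 'z \<Rightarrow> real) \<Rightarrow> 'z topology" where
  "pm_topology Z \<rho> =
     topology (\<lambda>U. U \<subseteq> Z \<and> (\<forall>x\<in>U. \<exists>r>0. {z \<in> Z. \<rho> x z < r} \<subseteq> U))"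

lemma openin_pm_topology:
  "openin (pm_topology Z \<rho>) U \<longleftrightarrow> U \<subseteq> Z \<and> (\<forall>x\<in>U. \<exists>r>0. {z \<in> Z. \<rho> x z < r} \<subseteq> U)"
proof -
  have "istopology (\<lambda>U. U \<subseteq> Z \<and> (\<forall>x\<in>U. \<exists>r>0. {z \<in> Z. \<rho> x z < r} \<subseteq> U))"
    unfolding istopology_def
  proof (intro conjI allI impI ballI)
    fix S T x
    assume S: "S \<subseteq> Z \<and> (\<forall>x\<in>S. \<exists>r>0. {z \<in> Z. \<rho> x z < r} \<subseteq> S)"
      and T: "T \<subseteq> Z \<and> (\<forall>x\<in>T. \<exists>r>0. {z \<in> Z. \<rho> x z < r} \<subseteq> T)" and x: "x \<in> S \<inter> T"
    obtain r s where "r > 0" "{z \<in> Z. \<rho> x z < r} \<subseteq> S" "s > 0" "{z \<in> Z. \<rho> x z < s} \<subseteq> T"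
      using S T x by blast
    then show "\<exists>r>0. {z \<in> Z. \<rho> x z < r} \<subseteq> S \<inter> T"
      by (intro exI[of _ "min r s"]) auto
  next
    fix \<K> x
    assume K: "\<forall>K\<in>\<K>. K \<subseteq> Z \<and> (\<forall>x\<in>K. \<exists>r>0. {z \<in> Z. \<rho> x z < r} \<subseteq> K)" and "x \<in> \<Union>\<K>"
    then obtain K r where "K \<in> \<K>" "r > 0" "{z \<in> Z. \<rho> x z < r} \<subseteq> K" by blast
    then show "\<exists>r>0. {z \<in> Z. \<rho> x z < r} \<subseteq> \<Union>\<K>" by blast
  qed blast+
  then show ?thesis
    unfolding pm_topology_def by (simp add: topology_inverse')
qed

definition map_topology ::
    "'z set \<Rightarrow> 'y topology \<Rightarrow> ('z \<Rightarrow> 'y) \<Rightarrow> ('z \<Rightarrow> 'z \<Rightarrow> real) \<Rightarrow> 'z topology" where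
  "map_topology Z Y g \<rho> = topology_generated_by
     ({U. openin (pm_topology Z \<rho>) U} \<union> {{z \<in> Z. g z \<in> V} |V. openin Y V})"

lemma topspace_map_topology: "topspace (map_topology Z Y g \<rho>) = Z"
proof -
  have "openin (pm_topology Z \<rho>) Z"
    unfolding openin_pm_topology by (auto intro: exI[of _ 1])
  moreover have "U \<subseteq> Z" if "openin (pm_topology Z \<rho>) U" for U
    using that by (simp add: openin_pm_topology)
  ultimately show ?thesis
    unfolding map_topology_def topology_generated_by_topspace by blast
qed


section \<open>Completeness\<close>

definition nbhds_in :: "'y topology \<Rightarrow> 'y \<Rightarrow> 'y set set" where
  "nbhds_in Y y = {N. N \<subseteq> topspace Y \<and> (\<exists>U. openin Y U \<and> y \<in> U \<and> U \<subseteq> N)}"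

text \<open>Diameters may be infinite; the empty set has diameter \<open>0\<close>.\<close>

definition diam :: "('z \<Rightarrow> 'z \<Rightarrow> real) \<Rightarrow> 'z set \<Rightarrow> ennreal" where
  "diam \<rho> A = (SUP p\<in>A \<times> A. ennreal (\<rho> (fst p) (snd p)))"

definition cluster_point_of :: "'z topology \<Rightarrow> 'z filter \<Rightarrow> 'z \<Rightarrow> bool" where
  "cluster_point_of T F z \<longleftrightarrow> z \<in> topspace T \<and>
     (\<forall>U A. openin T U \<and> z \<in> U \<and> (\<forall>\<^sub>F x in F. x \<in> A) \<longrightarrow> U \<inter> A \<noteq> {})"

text \<open>A (proper) filter on the set \<open>Z\<close> is a filter \<open>F \<noteq> bot\<close> on the type with
  \<open>F \<le> principal Z\<close>; a set \<open>A\<close> is a member iff \<open>\<forall>\<^sub>F x in F. x \<in> A\<close>.\<close>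

definition complete_on_map :: "'z set \<Rightarrow> 'y topology \<Rightarrow> ('z \<Rightarrow> 'y) \<Rightarrow> ('z \<Rightarrow> 'z \<Rightarrow> real) \<Rightarrow> bool" where
  "complete_on_map Z Y g \<rho> \<longleftrightarrow>
     (\<forall>y\<in>topspace Y. \<forall>F. F \<noteq> bot \<and> F \<le> principal Z \<and>
        (\<forall>N\<in>nbhds_in Y y. \<forall>\<^sub>F x in F. x \<in> {z \<in> Z. g z \<in> N}) \<and>
        (\<forall>\<epsilon>>0. \<exists>A\<subseteq>Z. (\<forall>\<^sub>F x in F. x \<in> A) \<and> diam \<rho> A < ennreal \<epsilon>) \<longrightarrow>
        (\<exists>z\<in>fibre Z g y. cluster_point_of (map_topology Z Y g \<rho>) F z))"

definition complete_metric_mapping ::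
    "'z set \<Rightarrow> 'y topology \<Rightarrow> ('z \<Rightarrow> 'y) \<Rightarrow> ('z \<Rightarrow> 'z \<Rightarrow> real) \<Rightarrow> bool" where
  "complete_metric_mapping Z Y g \<rho> \<longleftrightarrow> metric_mapping Z Y g \<rho> \<and> complete_on_map Z Y g \<rho>"

definition dense_isometric_embedding ::
    "'y topology \<Rightarrow> 'x set \<Rightarrow> ('x \<Rightarrow> 'y) \<Rightarrow> ('x \<Rightarrow> 'x \<Rightarrow> real) \<Rightarrow>
     'z set \<Rightarrow> ('z \<Rightarrow> 'y) \<Rightarrow> ('z \<Rightarrow> 'z \<Rightarrow> real) \<Rightarrow> ('x \<Rightarrow> 'z) \<Rightarrow> bool" where
  "dense_isometric_embedding Y X f d Z g \<rho> \<iota> \<longleftrightarrow>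
     \<iota> \<in> X \<rightarrow> Z \<and> inj_on \<iota> X \<and>
     continuous_map (map_topology X Y f d) (map_topology Z Y g \<rho>) \<iota> \<and>
     (\<forall>x\<in>X. g (\<iota> x) = f x) \<and>
     (\<forall>x\<in>X. \<forall>x'\<in>X. \<rho> (\<iota> x) (\<iota> x') = d x x') \<and>
     map_topology Z Y g \<rho> closure_of (\<iota> ` X) = Z"

definition is_completion ::
    "'y topology \<Rightarrow> 'x set \<Rightarrow> ('x \<Rightarrow> 'y) \<Rightarrow> ('x \<Rightarrow> 'x \<Rightarrow> real) \<Rightarrow>
     'z set \<Rightarrow> ('z \<Rightarrow> 'y) \<Rightarrow> ('z \<Rightarrow> 'z \<Rightarrow> real) \<Rightarrow> ('x \<Rightarrow> 'z) \<Rightarrow> bool" where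
  "is_completion Y X f d Z g \<rho> \<iota> \<longleftrightarrow>
     complete_metric_mapping Z Y g \<rho> \<and> dense_isometric_embedding Y X f d Z g \<rho> \<iota>"


section \<open>Nets\<close>

definition directed_set :: "'i set \<Rightarrow> 'i rel \<Rightarrow> bool" where
  "directed_set D r \<longleftrightarrow> D \<noteq> {} \<and> preorder_on D r \<and>
     (\<forall>a\<in>D. \<forall>b\<in>D. \<exists>c\<in>D. (a, c) \<in> r \<and> (b, c) \<in> r)"

record ('i, 'x) net =
  idx :: "'i set"
  ord :: "'i rel"
  pt :: "'i \<Rightarrow> 'x"

definition net_in :: "'x set \<Rightarrow> ('i, 'x) net \<Rightarrow> bool" where
  "net_in X \<Phi> \<longleftrightarrow> directed_set (idx \<Phi>) (ord \<Phi>) \<and> pt \<Phi> \<in> idx \<Phi> \<rightarrow>\<^sub>E X"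

text \<open>The filter of tails of a directed set: the limit of a net is the limit along it.\<close>

definition tails :: "'i set \<Rightarrow> 'i rel \<Rightarrow> 'i filter" where
  "tails D r = (INF a\<in>D. principal {b \<in> D. (a, b) \<in> r})"

lemma eventually_tails:
  assumes "directed_set D r"
  shows "eventually P (tails D r) \<longleftrightarrow> (\<exists>a\<in>D. \<forall>b\<in>D. (a, b) \<in> r \<longrightarrow> P b)"
proof -
  have "\<exists>c\<in>D. principal {x \<in> D. (c, x) \<in> r}
          \<le> inf (principal {x \<in> D. (a, x) \<in> r}) (principal {x \<in> D. (b, x) \<in> r})"
    if ab: "a \<in> D" "b \<in> D" for a b
  proof -
    have "trans r" using assms by (auto simp: directed_set_def preorder_on_def)
    moreover obtain c where "c \<in> D" "(a, c) \<in> r" "(b, c) \<in> r"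
      using assms ab unfolding directed_set_def by blast
    ultimately show ?thesis
      by (intro bexI[of _ c]) (auto dest: transD)
  qed
  then show ?thesis
    using assms unfolding tails_def
    by (subst eventually_INF_base) (auto simp: directed_set_def eventually_principal)
qed

definition prod_order :: "'i rel \<Rightarrow> 'j rel \<Rightarrow> ('i \<times> 'j) rel" where
  "prod_order r s = {((a, a'), (b, b')). (a, b) \<in> r \<and> (a', b') \<in> s}"

definition cauchy_net_tied ::
    "'x set \<Rightarrow> 'y topology \<Rightarrow> ('x \<Rightarrow> 'y) \<Rightarrow> ('x \<Rightarrow> 'x \<Rightarrow> real) \<Rightarrow> 'y \<Rightarrow> ('i, 'x) net \<Rightarrow> bool" where
  "cauchy_net_tied X Y f d y \<Phi> \<longleftrightarrow> net_in X \<Phi> \<and>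
     (\<forall>\<epsilon>>0. \<exists>\<alpha>\<in>idx \<Phi>. \<forall>\<beta>\<in>idx \<Phi>. \<forall>\<gamma>\<in>idx \<Phi>.
        (\<alpha>, \<beta>) \<in> ord \<Phi> \<and> (\<alpha>, \<gamma>) \<in> ord \<Phi> \<longrightarrow> d (pt \<Phi> \<beta>) (pt \<Phi> \<gamma>) < \<epsilon>) \<and>
     (\<forall>N\<in>nbhds_in Y y. \<exists>\<alpha>\<in>idx \<Phi>. \<forall>\<beta>\<in>idx \<Phi>. (\<alpha>, \<beta>) \<in> ord \<Phi> \<longrightarrow> f (pt \<Phi> \<beta>) \<in> N)"

definition net_equiv :: "('x \<Rightarrow> 'x \<Rightarrow> real) \<Rightarrow> ('i, 'x) net \<Rightarrow> ('j, 'x) net \<Rightarrow> bool" where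
  "net_equiv d \<Phi> \<Phi>' \<longleftrightarrow>
     (\<forall>\<epsilon>>0. \<exists>\<gamma>\<in>idx \<Phi>. \<exists>\<gamma>'\<in>idx \<Phi>'. \<forall>\<alpha>\<in>idx \<Phi>. \<forall>\<alpha>'\<in>idx \<Phi>'.
        (\<gamma>, \<alpha>) \<in> ord \<Phi> \<and> (\<gamma>', \<alpha>') \<in> ord \<Phi>' \<longrightarrow> d (pt \<Phi> \<alpha>) (pt \<Phi>' \<alpha>') < \<epsilon>)"

text \<open>All nets on \<open>X\<close> form a proper class, so a set of nets needs a bound on the index sets:
  here these are the subsets of a type \<open>'i\<close>. If \<open>Pow X \<lesssim> (UNIV :: 'i set)\<close> then nothing is
  lost: every Cauchy net, over whatever index type, is equivalent to one indexed in \<open>'i\<close>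
  (obtained by choosing a point from each set which contains a tail of the net, these sets being
  directed by reverse inclusion).\<close>

lemma cauchy_net_tied_reindex:
  fixes \<Psi> :: "('j, 'x) net"
  assumes le: "Pow X \<lesssim> (UNIV :: 'i set)" and \<Psi>: "cauchy_net_tied X Y f d y \<Psi>"
  shows "\<exists>\<Phi> :: ('i, 'x) net. cauchy_net_tied X Y f d y \<Phi> \<and> net_equiv d \<Psi> \<Phi>"
proof -
  obtain h :: "'x set \<Rightarrow> 'i" where h: "inj_on h (Pow X)"
    using le by (auto simp: lepoll_def)
  let ?J = "idx \<Psi>" and ?r = "ord \<Psi>" and ?p = "pt \<Psi>"
  have dir: "directed_set ?J ?r" and p: "\<And>a. a \<in> ?J \<Longrightarrow> ?p a \<in> X"
    using \<Psi> by (auto simp: cauchy_net_tied_def net_in_def)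
  have ne: "?J \<noteq> {}" and rfl: "\<And>a. a \<in> ?J \<Longrightarrow> (a, a) \<in> ?r" and tr: "trans ?r"
    and up: "\<And>a b. a \<in> ?J \<Longrightarrow> b \<in> ?J \<Longrightarrow> \<exists>c\<in>?J. (a, c) \<in> ?r \<and> (b, c) \<in> ?r"
    using dir by (auto simp: directed_set_def preorder_on_def refl_on_def)
  define tl where "tl a = ?p ` {b \<in> ?J. (a, b) \<in> ?r}" for a
  define G where "G = {A. A \<subseteq> X \<and> (\<exists>a\<in>?J. tl a \<subseteq> A)}"
  have GX: "G \<subseteq> Pow X" by (auto simp: G_def)
  have tlG: "tl a \<in> G" if "a \<in> ?J" for a
    using that p by (auto simp: G_def tl_def)
  have Gne: "A \<noteq> {}" if A: "A \<in> G" for A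
  proof -
    obtain a where "a \<in> ?J" "tl a \<subseteq> A" using A by (auto simp: G_def)
    then have "?p a \<in> A" using rfl by (auto simp: tl_def)
    then show ?thesis by blast
  qed
  define s where "s A = (SOME x. x \<in> A)" for A :: "'x set"
  have s: "s A \<in> A" if "A \<in> G" for A
    using Gne[OF that] unfolding s_def by (simp add: some_in_eq)
  have Int: "A \<inter> B \<in> G" if AB: "A \<in> G" "B \<in> G" for A B
  proof -
    obtain a b where ab: "a \<in> ?J" "tl a \<subseteq> A" "b \<in> ?J" "tl b \<subseteq> B"
      using AB unfolding G_def by blast
    obtain c where c: "c \<in> ?J" "(a, c) \<in> ?r" "(b, c) \<in> ?r" using up ab by blast
    have "tl c \<subseteq> tl a" "tl c \<subseteq> tl b"
      using c tr by (auto simp: tl_def dest: transD)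
    then have "tl c \<subseteq> A \<inter> B" using ab by blast
    then show ?thesis using AB c(1) by (auto simp: G_def)
  qed
  define \<Phi> :: "('i, 'x) net" where
    "\<Phi> = \<lparr>idx = h ` G, ord = {(h A, h B) |A B. A \<in> G \<and> B \<in> G \<and> B \<subseteq> A},
         pt = (\<lambda>k\<in>h ` G. s (inv_into (Pow X) h k))\<rparr>"
  have hinj: "h A = h B \<longleftrightarrow> A = B" if "A \<in> G" "B \<in> G" for A B
    using that GX h by (meson inj_on_eq_iff subsetD)
  have idx: "idx \<Phi> = h ` G" by (simp add: \<Phi>_def)
  have ord: "(h A, h B) \<in> ord \<Phi> \<longleftrightarrow> B \<subseteq> A" if "A \<in> G" "B \<in> G" for A B
    using that hinj by (fastforce simp: \<Phi>_def)
  have pt: "pt \<Phi> (h A) = s A" if "A \<in> G" for A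
    using that GX h by (auto simp: \<Phi>_def inv_into_f_f subset_iff)
  have "directed_set (idx \<Phi>) (ord \<Phi>)"
    unfolding directed_set_def preorder_on_def
  proof (intro conjI)
    show "idx \<Phi> \<noteq> {}" using ne tlG by (auto simp: idx)
    show "ord \<Phi> \<subseteq> idx \<Phi> \<times> idx \<Phi>" by (auto simp: \<Phi>_def)
    show "refl_on (idx \<Phi>) (ord \<Phi>)" by (auto simp: refl_on_def idx ord)
    show "trans (ord \<Phi>)"
    proof (rule transI)
      fix x y z assume "(x, y) \<in> ord \<Phi>" "(y, z) \<in> ord \<Phi>"
      then obtain A B B' C where "A \<in> G" "B \<in> G" "B' \<in> G" "C \<in> G" "B \<subseteq> A" "C \<subseteq> B'"
        "x = h A" "y = h B" "y = h B'" "z = h C"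
        by (auto simp: \<Phi>_def)
      then show "(x, z) \<in> ord \<Phi>" using hinj[of B B'] by (auto simp: ord)
    qed
    show "\<forall>a\<in>idx \<Phi>. \<forall>b\<in>idx \<Phi>. \<exists>c\<in>idx \<Phi>. (a, c) \<in> ord \<Phi> \<and> (b, c) \<in> ord \<Phi>"
      using Int by (auto simp: idx ord)
  qed
  moreover have "pt \<Phi> \<in> idx \<Phi> \<rightarrow>\<^sub>E X"
  proof (rule PiE_I)
    fix k assume "k \<in> idx \<Phi>"
    then obtain A where "A \<in> G" "k = h A" by (auto simp: idx)
    then show "pt \<Phi> k \<in> X" using s[of A] GX by (auto simp: pt)
  qed (auto simp: \<Phi>_def)
  ultimately have net: "net_in X \<Phi>" by (simp add: net_in_def)
  have tail: "\<exists>k\<in>idx \<Phi>. \<forall>l\<in>idx \<Phi>. (k, l) \<in> ord \<Phi> \<longrightarrow> pt \<Phi> l \<in> tl a" if a: "a \<in> ?J" for a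
  proof (intro bexI[of _ "h (tl a)"] ballI impI)
    fix l assume "l \<in> idx \<Phi>" "(h (tl a), l) \<in> ord \<Phi>"
    then obtain B where "B \<in> G" "l = h B" "B \<subseteq> tl a" using ord tlG[OF a] by (auto simp: idx)
    then show "pt \<Phi> l \<in> tl a" using s[of B] by (auto simp: pt)
  qed (use tlG[OF a] in \<open>auto simp: idx\<close>)
  have cau: "\<exists>a\<in>?J. \<forall>u\<in>tl a. \<forall>v\<in>tl a. d u v < \<epsilon>" if eps: "\<epsilon> > 0" for \<epsilon>
  proof -
    obtain a where "a \<in> ?J" "\<And>b c. b \<in> ?J \<Longrightarrow> c \<in> ?J \<Longrightarrow> (a, b) \<in> ?r \<Longrightarrow> (a, c) \<in> ?r \<Longrightarrow>
        d (?p b) (?p c) < \<epsilon>"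
      using \<Psi> eps unfolding cauchy_net_tied_def by blast
    then show ?thesis by (intro bexI[of _ a]) (auto simp: tl_def)
  qed
  have tied: "\<exists>a\<in>?J. \<forall>u\<in>tl a. f u \<in> N" if N: "N \<in> nbhds_in Y y" for N
  proof -
    obtain a where "a \<in> ?J" "\<And>b. b \<in> ?J \<Longrightarrow> (a, b) \<in> ?r \<Longrightarrow> f (?p b) \<in> N"
      using \<Psi> N unfolding cauchy_net_tied_def by blast
    then show ?thesis by (intro bexI[of _ a]) (auto simp: tl_def)
  qed
  have "cauchy_net_tied X Y f d y \<Phi>"
    unfolding cauchy_net_tied_def
  proof (intro conjI allI impI ballI net)
    fix \<epsilon> :: real assume "\<epsilon> > 0"
    then obtain a where a: "a \<in> ?J" "\<And>u v. u \<in> tl a \<Longrightarrow> v \<in> tl a \<Longrightarrow> d u v < \<epsilon>"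
      using cau by blast
    show "\<exists>\<alpha>\<in>idx \<Phi>. \<forall>\<beta>\<in>idx \<Phi>. \<forall>\<gamma>\<in>idx \<Phi>. (\<alpha>, \<beta>) \<in> ord \<Phi> \<and> (\<alpha>, \<gamma>) \<in> ord \<Phi> \<longrightarrow>
        d (pt \<Phi> \<beta>) (pt \<Phi> \<gamma>) < \<epsilon>"
      using tail[OF a(1)] a(2) by meson
  next
    fix N assume "N \<in> nbhds_in Y y"
    then obtain a where a: "a \<in> ?J" "\<And>u. u \<in> tl a \<Longrightarrow> f u \<in> N"
      using tied by blast
    show "\<exists>\<alpha>\<in>idx \<Phi>. \<forall>\<beta>\<in>idx \<Phi>. (\<alpha>, \<beta>) \<in> ord \<Phi> \<longrightarrow> f (pt \<Phi> \<beta>) \<in> N"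
      using tail[OF a(1)] a(2) by meson
  qed
  moreover have "net_equiv d \<Psi> \<Phi>"
    unfolding net_equiv_def
  proof (intro allI impI)
    fix \<epsilon> :: real assume "\<epsilon> > 0"
    then obtain a where a: "a \<in> ?J" "\<And>u v. u \<in> tl a \<Longrightarrow> v \<in> tl a \<Longrightarrow> d u v < \<epsilon>"
      using cau by blast
    obtain k where "k \<in> idx \<Phi>" "\<And>l. l \<in> idx \<Phi> \<Longrightarrow> (k, l) \<in> ord \<Phi> \<Longrightarrow> pt \<Phi> l \<in> tl a"
      using tail[OF a(1)] by blast
    with a show "\<exists>\<gamma>\<in>?J. \<exists>\<gamma>'\<in>idx \<Phi>. \<forall>\<alpha>\<in>?J. \<forall>\<alpha>'\<in>idx \<Phi>.
        (\<gamma>, \<alpha>) \<in> ?r \<and> (\<gamma>', \<alpha>') \<in> ord \<Phi> \<longrightarrow> d (?p \<alpha>) (pt \<Phi> \<alpha>') < \<epsilon>"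
      by (intro bexI[of _ a] bexI[of _ k]) (auto simp: tl_def)
  qed
  ultimately show ?thesis by blast
qed

definition cauchy_nets ::
    "'x set \<Rightarrow> 'y topology \<Rightarrow> ('x \<Rightarrow> 'y) \<Rightarrow> ('x \<Rightarrow> 'x \<Rightarrow> real) \<Rightarrow> 'y \<Rightarrow> ('i, 'x) net set" where
  "cauchy_nets X Y f d y = {\<Phi>. cauchy_net_tied X Y f d y \<Phi>}"

definition net_rel ::
    "'x set \<Rightarrow> 'y topology \<Rightarrow> ('x \<Rightarrow> 'y) \<Rightarrow> ('x \<Rightarrow> 'x \<Rightarrow> real) \<Rightarrow> 'y \<Rightarrow> ('i, 'x) net rel" where
  "net_rel X Y f d y =
     {(\<Phi>, \<Phi>'). \<Phi> \<in> cauchy_nets X Y f d y \<and> \<Phi>' \<in> cauchy_nets X Y f d y \<and> net_equiv d \<Phi> \<Phi>'}"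

definition net_class ::
    "'x set \<Rightarrow> 'y topology \<Rightarrow> ('x \<Rightarrow> 'y) \<Rightarrow> ('x \<Rightarrow> 'x \<Rightarrow> real) \<Rightarrow> 'y \<Rightarrow>
     ('i, 'x) net \<Rightarrow> ('i, 'x) net set" where
  "net_class X Y f d y \<Phi> = net_rel X Y f d y `` {\<Phi>}"


section \<open>The space of classes of Cauchy nets\<close>

definition star_space ::
    "'x set \<Rightarrow> 'y topology \<Rightarrow> ('x \<Rightarrow> 'y) \<Rightarrow> ('x \<Rightarrow> 'x \<Rightarrow> real) \<Rightarrow> (('i, 'x) net set \<times> 'y) set" where
  "star_space X Y f d = (\<Union>y\<in>topspace Y. (cauchy_nets X Y f d y // net_rel X Y f d y) \<times> {y})"

definition net_dist_tendsto ::
    "('x \<Rightarrow> 'x \<Rightarrow> real) \<Rightarrow> ('i, 'x) net \<Rightarrow> ('i, 'x) net \<Rightarrow> real \<Rightarrow> bool" where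
  "net_dist_tendsto d \<Phi> \<Phi>' L \<longleftrightarrow>
     ((\<lambda>(\<alpha>, \<alpha>'). d (pt \<Phi> \<alpha>) (pt \<Phi>' \<alpha>')) \<longlongrightarrow> L)
       (tails (idx \<Phi> \<times> idx \<Phi>') (prod_order (ord \<Phi>) (ord \<Phi>')))"

definition star_dist ::
    "('x \<Rightarrow> 'x \<Rightarrow> real) \<Rightarrow> ('i, 'x) net set \<times> 'y \<Rightarrow> ('i, 'x) net set \<times> 'y \<Rightarrow> real" where
  "star_dist d p q = (THE L. \<exists>\<Phi>\<in>fst p. \<exists>\<Phi>'\<in>fst q. net_dist_tendsto d \<Phi> \<Phi>' L)"

definition star_map :: "('i, 'x) net set \<times> 'y \<Rightarrow> 'y" where
  "star_map p = snd p"

text \<open>The parameter \<open>o\<^sub>0\<close> is the index called \<open>0\<close> in the constant net \<open>{0} \<rightarrow> X\<close>; the type \<open>'i\<close>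
  has no distinguished element.\<close>

definition const_net :: "'i \<Rightarrow> 'x \<Rightarrow> ('i, 'x) net" where
  "const_net o\<^sub>0 x = \<lparr>idx = {o\<^sub>0}, ord = {(o\<^sub>0, o\<^sub>0)}, pt = (\<lambda>\<alpha>\<in>{o\<^sub>0}. x)\<rparr>"

definition star_embed ::
    "'i \<Rightarrow> 'x set \<Rightarrow> 'y topology \<Rightarrow> ('x \<Rightarrow> 'y) \<Rightarrow> ('x \<Rightarrow> 'x \<Rightarrow> real) \<Rightarrow>
     'x \<Rightarrow> ('i, 'x) net set \<times> 'y" where
  "star_embed o\<^sub>0 X Y f d x = (net_class X Y f d (f x) (const_net o\<^sub>0 x), f x)"

end

(* Cauchy nets matter only through the filters of their tails. On the Cauchy filters of the
   pseudometric space X the limit of d along the product filter is a pseudometric; two nets tied to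
   the same point are equivalent iff their filters are at distance 0, so X* is the set of Cauchy
   filters tied to a point, up to distance 0. For completeness, a Cauchy filter F on X* is replaced
   by its diagonal filter on X: the sets that belong, for F-many points p, to the filter of a net
   representing p. It is Cauchy and tied to the same point, hence comes from a net on X, whose
   class is a cluster point of F. *)
theory Submission
  imports Defs
begin


text \<open>Filters on \<open>X\<close> also make nets over different index types comparable. Being
  tied to \<open>y\<close> is used through open sets: an open \<open>U\<close> containing
  \<open>y\<close> is a neighbourhood of each of its points, so a class lying over any point of
  \<open>U\<close> is represented by a filter that is eventually over \<open>U\<close>. Hence the
  diagonal filter is tied to \<open>y\<close> although the points met by \<open>F\<close> may lie
  over other points of \<open>Y\<close>. Using whole filters as representatives avoids choosing one
  point of \<open>X\<close> near each class with a controlled error. The price is size: a net for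
  the diagonal filter is naturally indexed by pointed subsets of \<open>X\<close>, while the points
  of the completion are classes of nets indexed in \<open>'i\<close>. The bound on
  \<open>Pow X\<close> allows the net to be moved there. The limit distance may vanish between
  classes over different points of \<open>Y\<close>, so separation is claimed only inside a
  fibre.\<close>

lemma map_topology_nbhd_base:
  assumes W: "openin (map_topology Z Y g \<rho>) W" "z \<in> W" and g: "g \<in> Z \<rightarrow> topspace Y"
  shows "\<exists>r>0. \<exists>U. openin Y U \<and> g z \<in> U \<and> {p \<in> Z. \<rho> z p < r \<and> g p \<in> U} \<subseteq> W"
proof -
  have "z \<in> Z"
    using W openin_subset topspace_map_topology by fastforce
  then have top: "openin Y (topspace Y)" "g z \<in> topspace Y"
    using g by auto
  have "generate_topology_on ({U. openin (pm_topology Z \<rho>) U} \<union> {{z \<in> Z. g z \<in> V} |V. openin Y V}) W"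
    using W by (simp add: map_topology_def openin_topology_generated_by_iff)
  then show ?thesis
    using \<open>z \<in> W\<close>
  \<comment> \<open>Sets of the form "ball around z, cut with the preimage of an open set" survive
    binary intersection: take the smaller radius and the intersection of the open sets.\<close>
  proof induction
    case (Int S T)
    obtain r U where "r > 0" "openin Y U" "g z \<in> U" "{p \<in> Z. \<rho> z p < r \<and> g p \<in> U} \<subseteq> S"
      using Int.IH(1) Int.prems by blast
    moreover obtain s V where "s > 0" "openin Y V" "g z \<in> V" "{p \<in> Z. \<rho> z p < s \<and> g p \<in> V} \<subseteq> T"
      using Int.IH(2) Int.prems by blast
    ultimately show ?case
      by (intro exI[of _ "min r s"] conjI exI[of _ "U \<inter> V"]) auto
  next
    case (UN K)
    then obtain k where "k \<in> K" "z \<in> k" by blast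
    with UN.IH[of k] show ?case by (meson Union_upper subset_trans)
  next
    case (Basis s)
    then consider "openin (pm_topology Z \<rho>) s" | V where "openin Y V" "s = {z \<in> Z. g z \<in> V}"
      by blast
    then show ?case
    proof cases
      case 1
      then obtain r where "r > 0" "{p \<in> Z. \<rho> z p < r} \<subseteq> s"
        using Basis.prems by (auto simp: openin_pm_topology)
      \<comment> \<open>A ball puts no restriction on the values of \<open>g\<close>, so the whole
        space serves as the open set; it contains \<open>g z\<close> because \<open>g\<close> maps
        into it.\<close>
      then show ?thesis using top by blast
    next
      case 2
      then show ?thesis using Basis.prems by (intro exI[of _ 1]) auto
    qed
  qed simp
qed


section \<open>Cauchy filters\<close>

locale pseudometric =
  fixes X :: "'x set" and d :: "'x \<Rightarrow> 'x \<Rightarrow> real"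
  assumes pseudometric: "pseudometric_on X d"
begin

lemma nonneg: "x \<in> X \<Longrightarrow> y \<in> X \<Longrightarrow> 0 \<le> d x y"
  and refl: "x \<in> X \<Longrightarrow> d x x = 0"
  and sym: "x \<in> X \<Longrightarrow> y \<in> X \<Longrightarrow> d x y = d y x"
  and triangle: "x \<in> X \<Longrightarrow> y \<in> X \<Longrightarrow> z \<in> X \<Longrightarrow> d x z \<le> d x y + d y z"
  using pseudometric by (auto simp: pseudometric_on_def)

text \<open>Lying in \<open>X\<close> is an eventual condition on the type because \<open>d\<close>
  is arbitrary off the carrier; every estimate first has to be cut down to \<open>X\<close>, which
  \<open>cauchyD\<close> does once and for all.\<close>

definition cauchy :: "'x filter \<Rightarrow> bool" where
  "cauchy F \<longleftrightarrow> F \<noteq> bot \<and> (\<forall>\<^sub>F x in F. x \<in> X) \<and>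
     (\<forall>\<epsilon>>0. \<exists>P. eventually P F \<and> (\<forall>x y. P x \<longrightarrow> P y \<longrightarrow> d x y < \<epsilon>))"

text \<open>This is the distance in the completion of \<open>X\<close> by Cauchy filters, before
  points at distance 0 are identified. \<open>Lim\<close> is a definite description; convergence and
  properness of the product filter give it its meaning on Cauchy filters.\<close>

definition fdist :: "'x filter \<Rightarrow> 'x filter \<Rightarrow> real" where
  "fdist F G = Lim (F \<times>\<^sub>F G) (\<lambda>(x, y). d x y)"

lemma cauchyD:
  assumes "cauchy F" "\<epsilon> > 0"
  obtains P where "eventually P F" "\<And>x. P x \<Longrightarrow> x \<in> X" "\<And>x y. P x \<Longrightarrow> P y \<Longrightarrow> d x y < \<epsilon>"
proof -
  obtain P where "eventually P F" "\<And>x y. P x \<Longrightarrow> P y \<Longrightarrow> d x y < \<epsilon>"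
    using assms unfolding cauchy_def by blast
  then show ?thesis
    using assms(1) by (intro that[of "\<lambda>x. P x \<and> x \<in> X"]) (auto simp: cauchy_def eventually_conj)
qed

lemma prod_filter_ne_bot:
  assumes "cauchy F" "cauchy G"
  shows "F \<times>\<^sub>F G \<noteq> bot"
  using assms by (simp add: cauchy_def prod_filter_eq_bot)

text \<open>By the triangle inequality d(x,y) and d(x',y') differ by at most d(x,x') + d(y,y'), so
  \<open>d\<close> sends the product of two Cauchy filters to a Cauchy filter of reals, and the
  reals are complete.\<close>

lemma fdist_tendsto:
  assumes F: "cauchy F" and G: "cauchy G"
  shows "((\<lambda>(x, y). d x y) \<longlongrightarrow> fdist F G) (F \<times>\<^sub>F G)"
proof -
  let ?d = "\<lambda>(x, y). d x y"
  have "cauchy_filter (filtermap ?d (F \<times>\<^sub>F G))"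
    unfolding cauchy_filter_metric_filtermap
  proof (intro allI impI)
    fix e :: real assume "e > 0"
    then have e: "e / 2 > 0" by simp
    obtain P where P: "eventually P F" "\<And>x. P x \<Longrightarrow> x \<in> X" "\<And>x y. P x \<Longrightarrow> P y \<Longrightarrow> d x y < e / 2"
      using cauchyD[OF F e] by blast
    obtain Q where Q: "eventually Q G" "\<And>x. Q x \<Longrightarrow> x \<in> X" "\<And>x y. Q x \<Longrightarrow> Q y \<Longrightarrow> d x y < e / 2"
      using cauchyD[OF G e] by blast
    have "dist (d x y) (d x' y') < e" if "P x" "P x'" "Q y" "Q y'" for x x' y y'
    proof -
      have "x \<in> X" "x' \<in> X" "y \<in> X" "y' \<in> X" using that P Q by auto
      then have "d x y \<le> d x x' + d x' y' + d y' y" "d x' y' \<le> d x' x + d x y + d y y'"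
        using triangle[of x x' y] triangle[of x' y' y] triangle[of x' x y'] triangle[of x y y']
        by auto
      then show ?thesis
        using P(3)[of x x'] P(3)[of x' x] Q(3)[of y y'] Q(3)[of y' y] that by (auto simp: dist_real_def)
    qed
    then show "\<exists>R. eventually R (F \<times>\<^sub>F G) \<and> (\<forall>x y. R x \<and> R y \<longrightarrow> dist (?d x) (?d y) < e)"
      using P(1) Q(1)
      by (intro exI[of _ "\<lambda>(x, y). P x \<and> Q y"]) (auto simp: eventually_prod_filter)
  qed
  moreover have "filtermap ?d (F \<times>\<^sub>F G) \<noteq> bot"
    using prod_filter_ne_bot[OF F G] by (simp add: filtermap_bot_iff)
  moreover have "complete (UNIV :: real set)"
    by (rule complete_UNIV)
  ultimately obtain L where "filtermap ?d (F \<times>\<^sub>F G) \<le> nhds L"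
    unfolding complete_uniform by auto
  then have "(?d \<longlongrightarrow> L) (F \<times>\<^sub>F G)" by (simp add: filterlim_def)
  then show ?thesis
    using prod_filter_ne_bot[OF F G] by (simp add: fdist_def tendsto_Lim)
qed

lemma fdist_eqI:
  assumes "cauchy F" "cauchy G" "((\<lambda>(x, y). d x y) \<longlongrightarrow> L) (F \<times>\<^sub>F G)"
  shows "fdist F G = L"
  unfolding fdist_def using assms prod_filter_ne_bot by (intro tendsto_Lim) auto

lemma fdist_near:
  assumes F: "cauchy F" and G: "cauchy G" and e: "e > 0"
  obtains P Q where "eventually P F" "eventually Q G" "\<And>x. P x \<Longrightarrow> x \<in> X" "\<And>x. Q x \<Longrightarrow> x \<in> X"
    "\<And>x y. P x \<Longrightarrow> Q y \<Longrightarrow> \<bar>d x y - fdist F G\<bar> < e"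
proof -
  have "\<forall>\<^sub>F p in F \<times>\<^sub>F G. dist (case p of (x, y) \<Rightarrow> d x y) (fdist F G) < e"
    using fdist_tendsto[OF F G] e by (rule tendstoD)
  then obtain P Q where "eventually P F" "eventually Q G"
    "\<And>x y. P x \<Longrightarrow> Q y \<Longrightarrow> \<bar>d x y - fdist F G\<bar> < e"
    by (auto simp: eventually_prod_filter dist_real_def)
  then show ?thesis
    using F G
    by (intro that[of "\<lambda>x. P x \<and> x \<in> X" "\<lambda>x. Q x \<and> x \<in> X"]) (auto simp: cauchy_def eventually_conj)
qed

lemma fdist_le:
  assumes "cauchy F" "cauchy G" "eventually P F" "eventually Q G"
    "\<And>x y. P x \<Longrightarrow> Q y \<Longrightarrow> d x y \<le> c"
  shows "fdist F G \<le> c"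
proof (rule tendsto_upperbound[OF fdist_tendsto[OF assms(1,2)]])
  show "\<forall>\<^sub>F p in F \<times>\<^sub>F G. (case p of (x, y) \<Rightarrow> d x y) \<le> c"
    using assms by (auto simp: eventually_prod_filter)
  show "F \<times>\<^sub>F G \<noteq> bot" using assms by (simp add: prod_filter_ne_bot)
qed

lemma fdist_nonneg:
  assumes F: "cauchy F" and G: "cauchy G"
  shows "0 \<le> fdist F G"
proof (rule tendsto_lowerbound[OF fdist_tendsto[OF F G]])
  show "\<forall>\<^sub>F p in F \<times>\<^sub>F G. 0 \<le> (case p of (x, y) \<Rightarrow> d x y)"
    unfolding eventually_prod_filter using F G nonneg
    by (intro exI[of _ "\<lambda>x. x \<in> X"]) (auto simp: cauchy_def)
  show "F \<times>\<^sub>F G \<noteq> bot" using F G by (simp add: prod_filter_ne_bot)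
qed

lemma fdist_refl:
  assumes F: "cauchy F"
  shows "fdist F F = 0"
proof (rule antisym)
  \<comment> \<open>The Cauchy condition bounds \<open>d\<close> on a square P x P, and such a
    square is a member of the product filter.\<close>
  show "fdist F F \<le> 0"
  proof (rule field_le_epsilon)
    fix e :: real assume "e > 0"
    then obtain P where "eventually P F" "\<And>x y. P x \<Longrightarrow> P y \<Longrightarrow> d x y < e"
      using cauchyD[OF F] by metis
    then show "fdist F F \<le> 0 + e"
      by (intro fdist_le[OF F F, of P P]) (auto intro: less_imp_le)
  qed
qed (use fdist_nonneg F in auto)

lemma eventually_exists:
  assumes "cauchy F" "eventually P F"
  obtains x where "P x"
  using assms eventually_happens by (metis cauchy_def)

lemma fdist_triangle:
  assumes F: "cauchy F" and G: "cauchy G" and H: "cauchy H"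
  shows "fdist F H \<le> fdist F G + fdist G H"
proof (rule field_le_epsilon)
  fix e :: real assume "e > 0"
  then have e: "e / 2 > 0" by simp
  obtain P Q where PQ: "eventually P F" "eventually Q G" "\<And>x. P x \<Longrightarrow> x \<in> X" "\<And>x. Q x \<Longrightarrow> x \<in> X"
    "\<And>x y. P x \<Longrightarrow> Q y \<Longrightarrow> \<bar>d x y - fdist F G\<bar> < e / 2"
    using fdist_near[OF F G e] by blast
  obtain R S where RS: "eventually R G" "eventually S H" "\<And>x. R x \<Longrightarrow> x \<in> X" "\<And>x. S x \<Longrightarrow> x \<in> X"
    "\<And>x y. R x \<Longrightarrow> S y \<Longrightarrow> \<bar>d x y - fdist G H\<bar> < e / 2"
    using fdist_near[OF G H e] by blast
  \<comment> \<open>Both conditions are eventual along the proper filter \<open>G\<close>, so one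
    middle point serves both estimates.\<close>
  obtain y where y: "Q y" "R y"
    using eventually_exists[OF G eventually_conj[OF PQ(2) RS(1)]] by blast
  show "fdist F H \<le> fdist F G + fdist G H + e"
  proof (rule fdist_le[OF F H PQ(1) RS(2)])
    fix x z assume "P x" "S z"
    then show "d x z \<le> fdist F G + fdist G H + e"
      using triangle[of x y z] PQ(3)[of x] PQ(4)[of y] RS(4)[of z] PQ(5)[of x y] RS(5)[of y z] y
      by linarith
  qed
qed

lemma fdist_sym:
  assumes F: "cauchy F" and G: "cauchy G"
  shows "fdist F G = fdist G F"
proof (rule fdist_eqI[OF F G])
  \<comment> \<open>Symmetry of \<open>d\<close> is available on \<open>X\<close> only, so the
    swapped function agrees with \<open>d\<close> eventually rather than everywhere.\<close>
  have "\<forall>\<^sub>F p in F \<times>\<^sub>F G. (case prod.swap p of (x, y) \<Rightarrow> d x y) = (case p of (x, y) \<Rightarrow> d x y)"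
    unfolding eventually_prod_filter using F G sym
    by (intro exI[of _ "\<lambda>x. x \<in> X"]) (auto simp: cauchy_def)
  moreover have "((\<lambda>p. case prod.swap p of (x, y) \<Rightarrow> d x y) \<longlongrightarrow> fdist G F) (F \<times>\<^sub>F G)"
    using fdist_tendsto[OF G F]
    by (simp add: prod_filter_commute[of G F] filterlim_filtermap)
  ultimately show "((\<lambda>(x, y). d x y) \<longlongrightarrow> fdist G F) (F \<times>\<^sub>F G)"
    by (rule Lim_transform_eventually[rotated])
qed

text \<open>This makes the distance independent of representatives: going from F to G through F' and
  G' costs nothing, and likewise in the other direction.\<close>

lemma fdist_cong:
  assumes F: "cauchy F" "cauchy F'" and G: "cauchy G" "cauchy G'"
    and "fdist F F' = 0" "fdist G G' = 0"
  shows "fdist F G = fdist F' G'"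
  using assms fdist_triangle[of F F' G] fdist_triangle[of F' G' G]
    fdist_triangle[of F' F G'] fdist_triangle[of F G G']
    fdist_sym[of F F'] fdist_sym[of G G'] by linarith

section \<open>Points of \<open>X\<close> as principal Cauchy filters\<close>

lemma cauchy_principal: "x \<in> X \<Longrightarrow> cauchy (principal {x})"
  unfolding cauchy_def
  by (auto simp: eventually_principal principal_eq_bot_iff refl intro!: exI[of _ "\<lambda>y. y = x"])

lemma fdist_principal:
  assumes "x \<in> X" "y \<in> X"
  shows "fdist (principal {x}) (principal {y}) = d x y"
proof (rule fdist_eqI)
  show "((\<lambda>(x, y). d x y) \<longlongrightarrow> d x y) (principal {x} \<times>\<^sub>F principal {y})"
    by (rule tendsto_eventually) (auto simp: principal_prod_principal eventually_principal)
qed (use assms cauchy_principal in auto)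

text \<open>The points of a Cauchy filter converge to that filter for the limit distance. Both
  density of the embedding and completeness rest on this.\<close>

lemma eventually_fdist_principal_less:
  assumes F: "cauchy F" and e: "e > 0"
  shows "\<forall>\<^sub>F x in F. x \<in> X \<and> fdist F (principal {x}) < e"
proof -
  \<comment> \<open>Passing to the limit turns a strict bound into a weak one; halving restores
    strictness.\<close>
  have "e / 2 > 0" using e by simp
  then obtain P where P: "eventually P F" "\<And>x. P x \<Longrightarrow> x \<in> X" "\<And>x y. P x \<Longrightarrow> P y \<Longrightarrow> d x y < e / 2"
    using cauchyD[OF F] by metis
  show ?thesis
  proof (rule eventually_mono[OF P(1)])
    fix x assume x: "P x"
    have "fdist F (principal {x}) \<le> e / 2"
      using P x by (intro fdist_le[OF F cauchy_principal P(1), of x "\<lambda>y. y = x"])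
        (auto simp: eventually_principal intro: less_imp_le)
    then show "x \<in> X \<and> fdist F (principal {x}) < e" using e P x by auto
  qed
qed

end


section \<open>Nets and their filters\<close>

definition net_filter :: "('i, 'x) net \<Rightarrow> 'x filter" where
  "net_filter \<Phi> = filtermap (pt \<Phi>) (tails (idx \<Phi>) (ord \<Phi>))"

lemma eventually_net_filter:
  assumes "net_in X \<Phi>"
  shows "eventually P (net_filter \<Phi>) \<longleftrightarrow>
    (\<exists>a\<in>idx \<Phi>. \<forall>b\<in>idx \<Phi>. (a, b) \<in> ord \<Phi> \<longrightarrow> P (pt \<Phi> b))"
  using assms by (simp add: net_filter_def net_in_def eventually_filtermap eventually_tails)

text \<open>Tails of the product order are rectangles of tails, and these form a base of the product
  filter. The limit over pairs of indices thereby becomes a limit along a product of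
  filters.\<close>

lemma tails_prod:
  assumes D: "directed_set D r" and E: "directed_set E s"
  shows "tails (D \<times> E) (prod_order r s) = tails D r \<times>\<^sub>F tails E s"
proof -
  have "directed_set (D \<times> E) (prod_order r s)"
    unfolding directed_set_def preorder_on_def
  proof (intro conjI)
    show "D \<times> E \<noteq> {}" "prod_order r s \<subseteq> (D \<times> E) \<times> D \<times> E" "refl_on (D \<times> E) (prod_order r s)"
      using D E by (auto simp: directed_set_def preorder_on_def refl_on_def prod_order_def)
    show "trans (prod_order r s)"
    proof -
      have "trans r" "trans s" using D E by (auto simp: directed_set_def preorder_on_def)
      then show ?thesis unfolding prod_order_def by (auto intro!: transI dest: transD)
    qed
    show "\<forall>a\<in>D \<times> E. \<forall>b\<in>D \<times> E. \<exists>c\<in>D \<times> E. (a, c) \<in> prod_order r s \<and> (b, c) \<in> prod_order r s"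
    proof clarify
      fix a b a' b' assume "a \<in> D" "b \<in> E" "a' \<in> D" "b' \<in> E"
      moreover from this D E obtain c c' where "c \<in> D" "(a, c) \<in> r" "(a', c) \<in> r"
        "c' \<in> E" "(b, c') \<in> s" "(b', c') \<in> s"
        unfolding directed_set_def by meson
      ultimately show "\<exists>c\<in>D \<times> E. ((a, b), c) \<in> prod_order r s \<and> ((a', b'), c) \<in> prod_order r s"
        by (intro bexI[of _ "(c, c')"]) (auto simp: prod_order_def)
    qed
  qed
  then have ev: "eventually P (tails (D \<times> E) (prod_order r s)) \<longleftrightarrow>
      (\<exists>a\<in>D. \<exists>b\<in>E. \<forall>x\<in>D. \<forall>y\<in>E. (a, x) \<in> r \<longrightarrow> (b, y) \<in> s \<longrightarrow> P (x, y))" for P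
    by (simp add: eventually_tails) (auto simp: prod_order_def; blast)
  have "eventually P (tails (D \<times> E) (prod_order r s)) \<longleftrightarrow> eventually P (tails D r \<times>\<^sub>F tails E s)"
    for P
    unfolding ev eventually_prod_filter eventually_tails[OF D] eventually_tails[OF E]
  proof
    assume "\<exists>a\<in>D. \<exists>b\<in>E. \<forall>x\<in>D. \<forall>y\<in>E. (a, x) \<in> r \<longrightarrow> (b, y) \<in> s \<longrightarrow> P (x, y)"
    then obtain a b where "a \<in> D" "b \<in> E" "\<forall>x\<in>D. \<forall>y\<in>E. (a, x) \<in> r \<longrightarrow> (b, y) \<in> s \<longrightarrow> P (x, y)"
      by blast
    then have "(\<exists>a\<in>D. \<forall>x\<in>D. (a, x) \<in> r \<longrightarrow> x \<in> D \<and> (a, x) \<in> r) \<and>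
        (\<exists>b\<in>E. \<forall>y\<in>E. (b, y) \<in> s \<longrightarrow> y \<in> E \<and> (b, y) \<in> s) \<and>
        (\<forall>x y. x \<in> D \<and> (a, x) \<in> r \<longrightarrow> y \<in> E \<and> (b, y) \<in> s \<longrightarrow> P (x, y))"
      by blast
    then show "\<exists>Pf Pg. (\<exists>a\<in>D. \<forall>b\<in>D. (a, b) \<in> r \<longrightarrow> Pf b) \<and>
        (\<exists>a\<in>E. \<forall>b\<in>E. (a, b) \<in> s \<longrightarrow> Pg b) \<and> (\<forall>x y. Pf x \<longrightarrow> Pg y \<longrightarrow> P (x, y))"
      by (intro exI[of _ "\<lambda>x. x \<in> D \<and> (a, x) \<in> r"] exI[of _ "\<lambda>y. y \<in> E \<and> (b, y) \<in> s"])
        (use \<open>a \<in> D\<close> \<open>b \<in> E\<close> in blast)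
  next
    assume "\<exists>Pf Pg. (\<exists>a\<in>D. \<forall>b\<in>D. (a, b) \<in> r \<longrightarrow> Pf b) \<and>
        (\<exists>a\<in>E. \<forall>b\<in>E. (a, b) \<in> s \<longrightarrow> Pg b) \<and> (\<forall>x y. Pf x \<longrightarrow> Pg y \<longrightarrow> P (x, y))"
    then show "\<exists>a\<in>D. \<exists>b\<in>E. \<forall>x\<in>D. \<forall>y\<in>E. (a, x) \<in> r \<longrightarrow> (b, y) \<in> s \<longrightarrow> P (x, y)"
      by meson
  qed
  then show ?thesis by (simp add: filter_eq_iff)
qed

lemma net_dist_tendsto_iff:
  assumes "net_in X \<Phi>" "net_in X' \<Phi>'"
  shows "net_dist_tendsto d \<Phi> \<Phi>' L \<longleftrightarrow>
    ((\<lambda>(x, y). d x y) \<longlongrightarrow> L) (net_filter \<Phi> \<times>\<^sub>F net_filter \<Phi>')"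
  using assms
  by (simp add: net_dist_tendsto_def net_filter_def net_in_def tails_prod prod_filtermap1
      prod_filtermap2 filtermap_filtermap filterlim_filtermap case_prod_unfold)

lemma net_in_const_net: "x \<in> X \<Longrightarrow> net_in X (const_net o\<^sub>0 x)"
  by (auto simp: net_in_def const_net_def directed_set_def preorder_on_def refl_on_def trans_def)

lemma net_filter_const_net: "net_filter (const_net o\<^sub>0 x) = principal {x}"
proof -
  have "net_in UNIV (const_net o\<^sub>0 x)" by (simp add: net_in_const_net)
  then show ?thesis
    by (auto simp: filter_eq_iff eventually_net_filter eventually_principal) (auto simp: const_net_def)
qed

text \<open>Each member A of the filter is paired with a point x of it, and pairs are ordered by
  reverse inclusion of the sets. Every z in A is then the value at (z, A), an index beyond (x, A),
  so the values on the tail of (x, A) fill exactly A. One chosen point per member could produce a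
  strictly finer filter. Pairs with the same set precede each other, as a preorder permits.\<close>

lemma ex_net_with_filter:
  assumes G: "G \<noteq> bot" "\<forall>\<^sub>F x in G. x \<in> X"
  obtains \<Phi> :: "('x \<times> 'x set, 'x) net" where "net_in X \<Phi>" "net_filter \<Phi> = G"
proof -
  define I where "I = {(x, A). x \<in> A \<and> A \<subseteq> X \<and> (\<forall>\<^sub>F x in G. x \<in> A)}"
  define \<Phi> :: "('x \<times> 'x set, 'x) net" where
    "\<Phi> = \<lparr>idx = I, ord = {(p, q). p \<in> I \<and> q \<in> I \<and> snd q \<subseteq> snd p}, pt = restrict fst I\<rparr>"
  have ex: "\<exists>x. (x, A) \<in> I" if "\<forall>\<^sub>F x in G. x \<in> A" "A \<subseteq> X" for A
    using that eventually_happens[OF that(1)] G by (auto simp: I_def)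
  have "directed_set (idx \<Phi>) (ord \<Phi>)"
    unfolding directed_set_def preorder_on_def
  proof (intro conjI ballI)
    show "idx \<Phi> \<noteq> {}" using ex[of X] G by (auto simp: \<Phi>_def)
    fix p q assume "p \<in> idx \<Phi>" "q \<in> idx \<Phi>"
    then have "p \<in> I" "q \<in> I" by (auto simp: \<Phi>_def)
    moreover from this obtain x where "(x, snd p \<inter> snd q) \<in> I"
      using ex[of "snd p \<inter> snd q"] by (auto simp: I_def eventually_conj_iff le_infI1)
    ultimately show "\<exists>c\<in>idx \<Phi>. (p, c) \<in> ord \<Phi> \<and> (q, c) \<in> ord \<Phi>"
      by (intro bexI[of _ "(x, snd p \<inter> snd q)"]) (auto simp: \<Phi>_def)
  qed (auto simp: \<Phi>_def refl_on_def trans_def)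
  then have net: "net_in X \<Phi>"
    by (auto simp: net_in_def \<Phi>_def I_def)
  have "eventually P (net_filter \<Phi>) \<longleftrightarrow> eventually P G" for P
    unfolding eventually_net_filter[OF net]
  proof
    assume "\<exists>a\<in>idx \<Phi>. \<forall>b\<in>idx \<Phi>. (a, b) \<in> ord \<Phi> \<longrightarrow> P (pt \<Phi> b)"
    then have "\<exists>a\<in>I. \<forall>b\<in>I. snd b \<subseteq> snd a \<longrightarrow> P (fst b)"
      by (auto simp: \<Phi>_def)
    then obtain x A where A: "(x, A) \<in> I" "\<And>b. b \<in> I \<Longrightarrow> snd b \<subseteq> A \<Longrightarrow> P (fst b)"
      by (metis prod.collapse snd_conv)
    have "P z" if "z \<in> A" for z
      using A(1) A(2)[of "(z, A)"] that by (auto simp: I_def)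
    moreover have "\<forall>\<^sub>F x in G. x \<in> A" using A(1) by (simp add: I_def)
    ultimately show "eventually P G" by (auto elim: eventually_mono)
  next
    assume "eventually P G"
    then have "\<forall>\<^sub>F x in G. x \<in> {x \<in> X. P x}" using G(2) by (auto intro: eventually_conj)
    then obtain x where "(x, {x \<in> X. P x}) \<in> I" using ex[of "{x \<in> X. P x}"] by auto
    then show "\<exists>a\<in>idx \<Phi>. \<forall>b\<in>idx \<Phi>. (a, b) \<in> ord \<Phi> \<longrightarrow> P (pt \<Phi> b)"
      by (intro bexI[of _ "(x, {x \<in> X. P x})"]) (auto simp: \<Phi>_def I_def)
  qed
  then show ?thesis
    using net by (intro that[of \<Phi>]) (auto simp: filter_eq_iff)
qed


section \<open>Classes of Cauchy nets\<close>

lemma net_filter_ne_bot: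
  assumes "net_in X \<Phi>"
  shows "net_filter \<Phi> \<noteq> bot"
proof
  assume "net_filter \<Phi> = bot"
  then have "eventually (\<lambda>_. False) (net_filter \<Phi>)" by simp
  then obtain a where "a \<in> idx \<Phi>" "(a, a) \<notin> ord \<Phi>"
    using assms by (auto simp: eventually_net_filter)
  then show False
    using assms by (auto simp: net_in_def directed_set_def preorder_on_def refl_on_def)
qed

lemma eventually_net_filter_in: "net_in X \<Phi> \<Longrightarrow> \<forall>\<^sub>F x in net_filter \<Phi>. x \<in> X"
  by (auto simp: eventually_net_filter) (auto simp: net_in_def directed_set_def)

context pseudometric
begin

text \<open>The images of the tails form a base of \<open>net_filter \<Phi>\<close>, so both
  conditions on a net are conditions on its filter. Open sets suffice because every neighbourhood
  contains an open one.\<close>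

lemma cauchy_net_tied_iff:
  "cauchy_net_tied X Y f d y \<Phi> \<longleftrightarrow> net_in X \<Phi> \<and> cauchy (net_filter \<Phi>) \<and>
     (\<forall>U. openin Y U \<and> y \<in> U \<longrightarrow> (\<forall>\<^sub>F x in net_filter \<Phi>. f x \<in> U))"
  (is "?L \<longleftrightarrow> ?R")
proof
  assume L: ?L
  then have net: "net_in X \<Phi>" by (simp add: cauchy_net_tied_def)
  have "\<exists>P. eventually P (net_filter \<Phi>) \<and> (\<forall>x y. P x \<longrightarrow> P y \<longrightarrow> d x y < \<epsilon>)" if "\<epsilon> > 0" for \<epsilon>
  proof -
    obtain a where a: "a \<in> idx \<Phi>" "\<forall>b\<in>idx \<Phi>. \<forall>c\<in>idx \<Phi>. (a, b) \<in> ord \<Phi> \<and> (a, c) \<in> ord \<Phi> \<longrightarrow>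
        d (pt \<Phi> b) (pt \<Phi> c) < \<epsilon>"
      using L \<open>\<epsilon> > 0\<close> unfolding cauchy_net_tied_def by blast
    then show ?thesis
      by (intro exI[of _ "\<lambda>x. \<exists>b\<in>idx \<Phi>. (a, b) \<in> ord \<Phi> \<and> x = pt \<Phi> b"])
        (auto simp: eventually_net_filter[OF net])
  qed
  then have "cauchy (net_filter \<Phi>)"
    unfolding cauchy_def using net_filter_ne_bot[OF net] eventually_net_filter_in[OF net] by blast
  moreover have "\<forall>\<^sub>F x in net_filter \<Phi>. f x \<in> U" if "openin Y U" "y \<in> U" for U
  proof -
    have "U \<in> nbhds_in Y y"
      using that openin_subset by (auto simp: nbhds_in_def)
    then show ?thesis
      using L unfolding cauchy_net_tied_def eventually_net_filter[OF net] by blast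
  qed
  ultimately show ?R using net by blast
next
  assume R: ?R
  then have net: "net_in X \<Phi>" by blast
  show ?L
    unfolding cauchy_net_tied_def
  proof (intro conjI allI impI ballI net)
    fix \<epsilon> :: real assume "\<epsilon> > 0"
    then obtain P where P: "eventually P (net_filter \<Phi>)" "\<And>x y. P x \<Longrightarrow> P y \<Longrightarrow> d x y < \<epsilon>"
      using R cauchyD by metis
    then obtain a where "a \<in> idx \<Phi>" "\<forall>b\<in>idx \<Phi>. (a, b) \<in> ord \<Phi> \<longrightarrow> P (pt \<Phi> b)"
      unfolding eventually_net_filter[OF net] by blast
    then show "\<exists>a\<in>idx \<Phi>. \<forall>b\<in>idx \<Phi>. \<forall>c\<in>idx \<Phi>. (a, b) \<in> ord \<Phi> \<and> (a, c) \<in> ord \<Phi> \<longrightarrow>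
        d (pt \<Phi> b) (pt \<Phi> c) < \<epsilon>"
      using P(2) by blast
  next
    fix N assume "N \<in> nbhds_in Y y"
    then obtain U where "openin Y U" "y \<in> U" "U \<subseteq> N" by (auto simp: nbhds_in_def)
    then have "\<forall>\<^sub>F x in net_filter \<Phi>. f x \<in> U" using R by blast
    then have "\<forall>\<^sub>F x in net_filter \<Phi>. f x \<in> N"
      by (rule eventually_mono) (use \<open>U \<subseteq> N\<close> in blast)
    then show "\<exists>a\<in>idx \<Phi>. \<forall>b\<in>idx \<Phi>. (a, b) \<in> ord \<Phi> \<longrightarrow> f (pt \<Phi> b) \<in> N"
      unfolding eventually_net_filter[OF net] .
  qed
qed

text \<open>That \<open>d\<close> drops below every positive bound on rectangles of tails means that
  its limit, which exists by the Cauchy property, is 0.\<close>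

lemma net_equiv_iff_fdist:
  assumes net: "net_in X \<Phi>" "net_in X \<Phi>'"
    and F: "cauchy (net_filter \<Phi>)" and G: "cauchy (net_filter \<Phi>')"
  shows "net_equiv d \<Phi> \<Phi>' \<longleftrightarrow> fdist (net_filter \<Phi>) (net_filter \<Phi>') = 0"
proof
  assume eq: "net_equiv d \<Phi> \<Phi>'"
  have "fdist (net_filter \<Phi>) (net_filter \<Phi>') \<le> 0"
  proof (rule field_le_epsilon)
    fix e :: real assume "e > 0"
    then obtain a b where ab: "a \<in> idx \<Phi>" "b \<in> idx \<Phi>'"
      "\<forall>x\<in>idx \<Phi>. \<forall>y\<in>idx \<Phi>'. (a, x) \<in> ord \<Phi> \<and> (b, y) \<in> ord \<Phi>' \<longrightarrow> d (pt \<Phi> x) (pt \<Phi>' y) < e"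
      using eq unfolding net_equiv_def by meson
    show "fdist (net_filter \<Phi>) (net_filter \<Phi>') \<le> 0 + e"
    proof (rule fdist_le[OF F G])
      show "\<forall>\<^sub>F x in net_filter \<Phi>. \<exists>k\<in>idx \<Phi>. (a, k) \<in> ord \<Phi> \<and> x = pt \<Phi> k"
        "\<forall>\<^sub>F y in net_filter \<Phi>'. \<exists>k\<in>idx \<Phi>'. (b, k) \<in> ord \<Phi>' \<and> y = pt \<Phi>' k"
        using ab net by (auto simp: eventually_net_filter)
    qed (use ab in \<open>auto intro: less_imp_le\<close>)
  qed
  then show "fdist (net_filter \<Phi>) (net_filter \<Phi>') = 0"
    using fdist_nonneg[OF F G] by simp
next
  assume 0: "fdist (net_filter \<Phi>) (net_filter \<Phi>') = 0"
  show "net_equiv d \<Phi> \<Phi>'"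
    unfolding net_equiv_def
  proof (intro allI impI)
    fix e :: real assume e: "e > 0"
    obtain P Q where PQ: "eventually P (net_filter \<Phi>)" "eventually Q (net_filter \<Phi>')"
      "\<And>x. P x \<Longrightarrow> x \<in> X" "\<And>x. Q x \<Longrightarrow> x \<in> X"
      "\<And>x y. P x \<Longrightarrow> Q y \<Longrightarrow> \<bar>d x y - fdist (net_filter \<Phi>) (net_filter \<Phi>')\<bar> < e"
      using fdist_near[OF F G e] by blast
    obtain a where a: "a \<in> idx \<Phi>" "\<forall>k\<in>idx \<Phi>. (a, k) \<in> ord \<Phi> \<longrightarrow> P (pt \<Phi> k)"
      using PQ(1) unfolding eventually_net_filter[OF net(1)] by blast
    obtain b where b: "b \<in> idx \<Phi>'" "\<forall>k\<in>idx \<Phi>'. (b, k) \<in> ord \<Phi>' \<longrightarrow> Q (pt \<Phi>' k)"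
      using PQ(2) unfolding eventually_net_filter[OF net(2)] by blast
    have "d (pt \<Phi> x) (pt \<Phi>' y) < e"
      if "x \<in> idx \<Phi>" "y \<in> idx \<Phi>'" "(a, x) \<in> ord \<Phi>" "(b, y) \<in> ord \<Phi>'" for x y
      using PQ(5)[of "pt \<Phi> x" "pt \<Phi>' y"] a b that 0 by auto
    then show "\<exists>a\<in>idx \<Phi>. \<exists>b\<in>idx \<Phi>'. \<forall>x\<in>idx \<Phi>. \<forall>y\<in>idx \<Phi>'.
        (a, x) \<in> ord \<Phi> \<and> (b, y) \<in> ord \<Phi>' \<longrightarrow> d (pt \<Phi> x) (pt \<Phi>' y) < e"
      using a(1) b(1) by blast
  qed
qed

end

text \<open>Besides naming the index of the constant nets, \<open>o\<^sub>0\<close> fixes the type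
  \<open>'i\<close> for the whole locale, so that the abbreviations below speak of one space of
  classes.\<close>

locale metric_map = pseudometric X d for X :: "'x set" and d +
  fixes Y :: "'y topology" and f :: "'x \<Rightarrow> 'y" and o\<^sub>0 :: 'i
  assumes f: "f \<in> X \<rightarrow> topspace Y" and metric: "metric_on_map X Y f d"
begin

abbreviation CN :: "'y \<Rightarrow> ('i, 'x) net set" where "CN \<equiv> cauchy_nets X Y f d"
abbreviation NR :: "'y \<Rightarrow> ('i, 'x) net rel" where "NR \<equiv> net_rel X Y f d"
abbreviation NC :: "'y \<Rightarrow> ('i, 'x) net \<Rightarrow> ('i, 'x) net set" where "NC \<equiv> net_class X Y f d"
abbreviation XS :: "(('i, 'x) net set \<times> 'y) set" where "XS \<equiv> star_space X Y f d"
abbreviation emb :: "'x \<Rightarrow> ('i, 'x) net set \<times> 'y" where "emb \<equiv> star_embed o\<^sub>0 X Y f d"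
abbreviation TS :: "(('i, 'x) net set \<times> 'y) topology" where
  "TS \<equiv> map_topology XS Y star_map (star_dist d)"

text \<open>Separation in a fibre, freed from the cut-off in \<open>dist_restrict\<close>;
  injectivity of the embedding comes from it.\<close>

lemma eq_if_dist_0:
  assumes "x \<in> X" "x' \<in> X" "f x = f x'" "d x x' = 0"
  shows "x = x'"
proof -
  let ?S = "fibre X f (f x)"
  have "f x \<in> topspace Y" using f assms by auto
  then have "Metric_space ?S (dist_restrict ?S d)"
    using metric by (simp add: metric_on_map_def)
  then show ?thesis
    using Metric_space.zero[of ?S _ x x'] assms by (fastforce simp: fibre_def dist_restrict_def)
qed

lemma CN_D:
  assumes "\<Phi> \<in> CN y"
  shows "net_in X \<Phi>" "cauchy (net_filter \<Phi>)"
    "openin Y U \<Longrightarrow> y \<in> U \<Longrightarrow> \<forall>\<^sub>F x in net_filter \<Phi>. f x \<in> U"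
  using assms unfolding cauchy_nets_def cauchy_net_tied_iff by auto

lemma net_rel_iff:
  "(\<Phi>, \<Phi>') \<in> NR y \<longleftrightarrow> \<Phi> \<in> CN y \<and> \<Phi>' \<in> CN y \<and> fdist (net_filter \<Phi>) (net_filter \<Phi>') = 0"
proof (cases "\<Phi> \<in> CN y \<and> \<Phi>' \<in> CN y")
  case True
  then show ?thesis
    using net_equiv_iff_fdist[OF CN_D(1) CN_D(1) CN_D(2) CN_D(2), of \<Phi> y \<Phi>' y y y]
    by (simp add: net_rel_def)
qed (auto simp: net_rel_def)

text \<open>The relation is "distance 0" for the pseudometric \<open>fdist\<close>, pulled back to
  nets.\<close>

lemma equiv_net_rel: "equiv (CN y) (NR y)"
proof (rule equivI)
  show "NR y \<subseteq> CN y \<times> CN y" by (auto simp: net_rel_iff)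
  show "refl_on (CN y) (NR y)" by (auto simp: refl_on_def net_rel_iff intro: fdist_refl CN_D(2))
  show "sym (NR y)"
  proof (rule symI)
    fix \<Phi> \<Phi>' assume "(\<Phi>, \<Phi>') \<in> NR y"
    then show "(\<Phi>', \<Phi>) \<in> NR y"
      using fdist_sym[OF CN_D(2) CN_D(2), of \<Phi> y \<Phi>' y] by (simp add: net_rel_iff)
  qed
  show "trans (NR y)"
  proof (rule transI)
    fix \<Phi> \<Phi>' \<Phi>'' assume "(\<Phi>, \<Phi>') \<in> NR y" "(\<Phi>', \<Phi>'') \<in> NR y"
    then show "(\<Phi>, \<Phi>'') \<in> NR y"
      using fdist_triangle[of "net_filter \<Phi>" "net_filter \<Phi>'" "net_filter \<Phi>''"]
        fdist_nonneg[of "net_filter \<Phi>" "net_filter \<Phi>''"]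
        CN_D(2)[of \<Phi> y] CN_D(2)[of \<Phi>' y] CN_D(2)[of \<Phi>'' y]
      by (simp add: net_rel_iff)
  qed
qed

section \<open>Points of the space of classes and their representatives\<close>

lemma star_spaceD:
  assumes "p \<in> XS"
  shows "snd p \<in> topspace Y" "fst p \<in> CN (snd p) // NR (snd p)"
  using assms by (auto simp: star_space_def)

lemma rep_in_CN: "p \<in> XS \<Longrightarrow> \<Phi> \<in> fst p \<Longrightarrow> \<Phi> \<in> CN (snd p)"
  using in_quotient_imp_subset[OF equiv_net_rel star_spaceD(2)] by blast

lemma fst_nonempty: "p \<in> XS \<Longrightarrow> fst p \<noteq> {}"
  using in_quotient_imp_non_empty[OF equiv_net_rel star_spaceD(2)] .

lemma fdist_same_class:
  assumes "p \<in> XS" "\<Phi> \<in> fst p" "\<Phi>' \<in> fst p"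
  shows "fdist (net_filter \<Phi>) (net_filter \<Phi>') = 0"
  using in_quotient_imp_in_rel[OF equiv_net_rel star_spaceD(2)[OF assms(1)], of \<Phi> \<Phi>'] assms
  by (simp add: net_rel_iff)

lemma net_dist_tendsto_iff_fdist:
  assumes "\<Phi> \<in> CN y" "\<Phi>' \<in> CN y'"
  shows "net_dist_tendsto d \<Phi> \<Phi>' L \<longleftrightarrow> L = fdist (net_filter \<Phi>) (net_filter \<Phi>')"
  unfolding net_dist_tendsto_iff[OF CN_D(1)[OF assms(1)] CN_D(1)[OF assms(2)]]
  using fdist_tendsto fdist_eqI CN_D(2)[OF assms(1)] CN_D(2)[OF assms(2)] by blast

text \<open>\<open>star_dist\<close> describes the real that is a limit for some pair of
  representatives. For each pair the limit exists and is unique, and by \<open>fdist_cong\<close>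
  all pairs have the same one, so the description is proper.\<close>

lemma star_dist_eq:
  assumes p: "p \<in> XS" "\<Phi> \<in> fst p" and q: "q \<in> XS" "\<Phi>' \<in> fst q"
  shows "star_dist d p q = fdist (net_filter \<Phi>) (net_filter \<Phi>')"
proof -
  have "L = fdist (net_filter \<Phi>) (net_filter \<Phi>')"
    if "\<Psi> \<in> fst p" "\<Psi>' \<in> fst q" "net_dist_tendsto d \<Psi> \<Psi>' L" for \<Psi> \<Psi>' L
  proof -
    have "L = fdist (net_filter \<Psi>) (net_filter \<Psi>')"
      using that net_dist_tendsto_iff_fdist[OF rep_in_CN[OF p(1)] rep_in_CN[OF q(1)]] by blast
    also have "\<dots> = fdist (net_filter \<Phi>) (net_filter \<Phi>')"
      using that p q CN_D(2)[OF rep_in_CN[OF p(1)]] CN_D(2)[OF rep_in_CN[OF q(1)]]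
      by (intro fdist_cong fdist_same_class[OF p(1)] fdist_same_class[OF q(1)])
    finally show ?thesis .
  qed
  moreover have "net_dist_tendsto d \<Phi> \<Phi>' (fdist (net_filter \<Phi>) (net_filter \<Phi>'))"
    using net_dist_tendsto_iff_fdist[OF rep_in_CN[OF p] rep_in_CN[OF q]] by blast
  ultimately show ?thesis
    unfolding star_dist_def using p q by (intro the_equality) blast+
qed

lemma net_class_in_XS: "\<Phi> \<in> CN y \<Longrightarrow> y \<in> topspace Y \<Longrightarrow> (NC y \<Phi>, y) \<in> XS"
  by (auto simp: star_space_def net_class_def intro: quotientI)

lemma self_in_net_class: "\<Phi> \<in> CN y \<Longrightarrow> \<Phi> \<in> NC y \<Phi>"
  by (simp add: net_class_def net_rel_iff fdist_refl[OF CN_D(2)])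

text \<open>With one filter chosen per class, \<open>star_dist\<close> is \<open>fdist\<close>
  pulled back along \<open>rep\<close>, and its properties transfer without further work in the
  quotient.\<close>

definition rep :: "('i, 'x) net set \<times> 'y \<Rightarrow> 'x filter" where
  "rep p = net_filter (SOME \<Phi>. \<Phi> \<in> fst p)"

lemma some_in_fst: "p \<in> XS \<Longrightarrow> (SOME \<Phi>. \<Phi> \<in> fst p) \<in> fst p"
  by (simp only: some_in_eq fst_nonempty not_False_eq_True)

lemma rep_props:
  assumes "p \<in> XS"
  shows cauchy_rep: "cauchy (rep p)"
    and eventually_rep: "openin Y U \<Longrightarrow> snd p \<in> U \<Longrightarrow> \<forall>\<^sub>F x in rep p. f x \<in> U"
proof -
  have "(SOME \<Phi>. \<Phi> \<in> fst p) \<in> CN (snd p)"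
    using assms by (intro rep_in_CN some_in_fst)
  then show "cauchy (rep p)" "openin Y U \<Longrightarrow> snd p \<in> U \<Longrightarrow> \<forall>\<^sub>F x in rep p. f x \<in> U"
    unfolding rep_def by (auto dest: CN_D)
qed

lemma star_dist_rep:
  assumes "p \<in> XS" "q \<in> XS"
  shows "star_dist d p q = fdist (rep p) (rep q)"
  unfolding rep_def using assms by (intro star_dist_eq some_in_fst)

text \<open>The chosen filter need not be the filter of the given net; only its distance from it is
  controlled.\<close>

lemma fdist_rep_net_class:
  assumes "\<Phi> \<in> CN y" "y \<in> topspace Y"
  shows "fdist (net_filter \<Phi>) (rep (NC y \<Phi>, y)) = 0"
  unfolding rep_def
proof (rule fdist_same_class)
  show "(NC y \<Phi>, y) \<in> XS" using assms by (rule net_class_in_XS)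
  then show "(SOME \<Phi>'. \<Phi>' \<in> fst (NC y \<Phi>, y)) \<in> fst (NC y \<Phi>, y)"
    by (rule some_in_fst)
  show "\<Phi> \<in> fst (NC y \<Phi>, y)" using assms self_in_net_class by simp
qed

lemma pseudometric_star: "pseudometric_on XS (star_dist d)"
  unfolding pseudometric_on_def
proof (intro conjI ballI)
  fix p q r assume "p \<in> XS" "q \<in> XS" "r \<in> XS"
  then show "star_dist d p r \<le> star_dist d p q + star_dist d q r"
    by (simp add: star_dist_rep fdist_triangle cauchy_rep)
next
  fix p q assume pq: "p \<in> XS" "q \<in> XS"
  show "0 \<le> star_dist d p q" using pq by (simp add: star_dist_rep fdist_nonneg cauchy_rep)
  show "star_dist d p q = star_dist d q p"
    using pq fdist_sym[of "rep p" "rep q"] by (simp add: star_dist_rep cauchy_rep)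
next
  fix p assume "p \<in> XS"
  then show "star_dist d p p = 0" by (simp add: star_dist_rep fdist_refl cauchy_rep)
qed

text \<open>Over a common point of \<open>Y\<close> distance 0 is the very relation that was
  factored out, so the two classes coincide.\<close>

lemma star_eqI:
  assumes p: "p \<in> XS" and q: "q \<in> XS" and "snd p = snd q" "star_dist d p q = 0"
  shows "p = q"
proof (rule prod_eqI)
  obtain \<Phi> \<Phi>' where m: "\<Phi> \<in> fst p" "\<Phi>' \<in> fst q"
    using p q fst_nonempty by blast
  have "(\<Phi>, \<Phi>') \<in> NR (snd p)"
    using assms m rep_in_CN[OF p] rep_in_CN[OF q] star_dist_eq[OF p m(1) q m(2)]
    by (simp add: net_rel_iff)
  then show "fst p = fst q"
    using quotient_eqI[OF equiv_net_rel star_spaceD(2)[OF p]] star_spaceD(2)[OF q] m \<open>snd p = snd q\<close>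
    by metis
qed fact

lemma metric_star: "metric_on_map XS Y star_map (star_dist d)"
  unfolding metric_on_map_def
proof (intro conjI pseudometric_star ballI)
  fix y assume "y \<in> topspace Y"
  let ?S = "fibre XS star_map y"
  interpret S: pseudometric XS "star_dist d" using pseudometric_star by unfold_locales
  have sub: "?S \<subseteq> XS" by (auto simp: fibre_def)
  show "Metric_space ?S (dist_restrict ?S (star_dist d))"
  proof
    fix p q r
    show "0 \<le> dist_restrict ?S (star_dist d) p q"
      using sub S.nonneg[of p q] by (auto simp: dist_restrict_def simp del: split_paired_All)
    show "dist_restrict ?S (star_dist d) p q = dist_restrict ?S (star_dist d) q p"
      using sub S.sym[of p q] by (auto simp: dist_restrict_def)
    show "dist_restrict ?S (star_dist d) p q = 0 \<longleftrightarrow> p = q" if "p \<in> ?S" "q \<in> ?S"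
      using that S.refl[of p] star_eqI[of p q] by (auto simp: dist_restrict_def fibre_def star_map_def)
    show "dist_restrict ?S (star_dist d) p r
        \<le> dist_restrict ?S (star_dist d) p q + dist_restrict ?S (star_dist d) q r"
      if "p \<in> ?S" "q \<in> ?S" "r \<in> ?S"
      using that sub S.triangle[of p q r] by (auto simp: dist_restrict_def)
  qed
qed

lemma star_map_in: "star_map \<in> XS \<rightarrow> topspace Y"
  using star_spaceD(1) by (auto simp: star_map_def)


section \<open>The embedding\<close>

lemma const_net_in_CN:
  assumes "x \<in> X"
  shows "const_net o\<^sub>0 x \<in> CN (f x)"
  using assms
  by (auto simp: cauchy_nets_def cauchy_net_tied_iff net_in_const_net net_filter_const_net
      cauchy_principal eventually_principal)

lemma embed_in_XS: "x \<in> X \<Longrightarrow> emb x \<in> XS"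
  unfolding star_embed_def using f const_net_in_CN by (intro net_class_in_XS) auto

lemma star_dist_embed:
  assumes p: "p \<in> XS" and x: "x \<in> X"
  shows "star_dist d p (emb x) = fdist (rep p) (principal {x})"
proof -
  have "fdist (principal {x}) (rep (emb x)) = 0"
    using fdist_rep_net_class[OF const_net_in_CN, of x] x f
    by (auto simp: net_filter_const_net star_embed_def)
  moreover have c: "cauchy (rep p)" "cauchy (rep (emb x))" "cauchy (principal {x})"
    using p x by (simp_all add: cauchy_rep embed_in_XS cauchy_principal)
  ultimately have "fdist (rep p) (rep (emb x)) = fdist (rep p) (principal {x})"
    using fdist_cong[OF c(1,1,2,3) fdist_refl[OF c(1)]] fdist_sym[OF c(2,3)] by simp
  then show ?thesis
    using p x by (simp add: star_dist_rep embed_in_XS)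
qed

lemma star_dist_embed_embed:
  assumes "x \<in> X" "x' \<in> X"
  shows "star_dist d (emb x) (emb x') = d x x'"
proof -
  have "star_dist d (emb x) (emb x') =
      fdist (principal {x}) (principal {x'})"
    using assms f star_dist_eq[OF embed_in_XS _ embed_in_XS,
        of x "const_net o\<^sub>0 x" x' "const_net o\<^sub>0 x'"]
    by (simp add: star_embed_def self_in_net_class const_net_in_CN net_filter_const_net)
  then show ?thesis using assms by (simp add: fdist_principal)
qed

lemma inj_on_embed: "inj_on emb X"
proof (rule inj_onI)
  fix x x' assume x: "x \<in> X" "x' \<in> X" and eq: "emb x = emb x'"
  \<comment> \<open>By isometry d(x,x') is the distance of two equal images, which is also
    d(x',x').\<close>
  have "d x x' = 0"
    using star_dist_embed_embed[OF x] star_dist_embed_embed[OF x(2,2)] eq refl[OF x(2)]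
    by simp
  moreover have "f x = f x'" using eq by (simp add: star_embed_def)
  ultimately show "x = x'" using eq_if_dist_0 x by blast
qed

text \<open>It is enough to pull back the subbase: by isometry a ball around x maps into the ball of
  the same radius around its image, and preimages of open sets of \<open>Y\<close> pull back to
  preimages under \<open>f\<close>.\<close>

lemma continuous_embed:
  "continuous_map (map_topology X Y f d) TS
     emb"
  (is "continuous_map ?T _ emb")
proof -
  have sub: "openin ?T W" if "openin (pm_topology X d) W \<or> (\<exists>V. openin Y V \<and> W = {x \<in> X. f x \<in> V})"
    for W
    using that unfolding map_topology_def by (intro topology_generated_by_Basis) blast
  show ?thesis
    unfolding map_topology_def[of XS]
  proof (rule continuous_on_generated_topo)
    fix W
    assume "W \<in> {U. openin (pm_topology XS (star_dist d)) U} \<union> {{z \<in> XS. star_map z \<in> V} |V. openin Y V}"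
    then consider "openin (pm_topology XS (star_dist d)) W"
      | V where "openin Y V" "W = {z \<in> XS. star_map z \<in> V}" by blast
    then have "openin ?T (emb -` W \<inter> X)"
    proof cases
      case 1
      have "openin (pm_topology X d) (emb -` W \<inter> X)"
        unfolding openin_pm_topology
      proof (intro conjI ballI)
        fix x assume x: "x \<in> emb -` W \<inter> X"
        then obtain r where "r > 0" "{z \<in> XS. star_dist d (emb x) z < r} \<subseteq> W"
          using 1 by (auto simp: openin_pm_topology)
        moreover have "emb z \<in> {q \<in> XS. star_dist d (emb x) q < r}" if "z \<in> X" "d x z < r" for z
          using x that star_dist_embed_embed[of x z] embed_in_XS[of z] by simp
        ultimately show "\<exists>r>0. {z \<in> X. d x z < r} \<subseteq> emb -` W \<inter> X"
          by (intro exI[of _ r]) blast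
      qed simp
      then show ?thesis using sub by blast
    next
      case 2
      then have "emb -` W \<inter> X = {x \<in> X. f x \<in> V}"
        using embed_in_XS by (auto simp: star_map_def star_embed_def)
      then show ?thesis using sub 2 by blast
    qed
    then show "openin ?T (emb -` W \<inter> topspace ?T)"
      by (simp add: topspace_map_topology)
  next
    have "\<Union> ({U. openin (pm_topology XS (star_dist d)) U} \<union>
        {{z \<in> XS. star_map z \<in> V} |V. openin Y V}) = XS"
      using topspace_map_topology[of XS Y star_map "star_dist d"]
      by (simp only: map_topology_def topology_generated_by_topspace)
    then show "emb ` topspace ?T \<subseteq> \<Union> ({U. openin (pm_topology XS (star_dist d)) U} \<union>
        {{z \<in> XS. star_map z \<in> V} |V. openin Y V})"
      using embed_in_XS by (auto simp only: topspace_map_topology)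
  qed
qed

lemma dense_embed: "TS closure_of (emb ` X) = XS"
proof
  show "TS closure_of (emb ` X) \<subseteq> XS"
    using closure_of_subset_topspace topspace_map_topology by metis
  show "XS \<subseteq> TS closure_of (emb ` X)"
  proof
    fix p :: "('i, 'x) net set \<times> 'y" assume p: "p \<in> XS"
    have "\<exists>q\<in>emb ` X. q \<in> W" if W: "p \<in> W" "openin TS W" for W
    proof -
      obtain r U where rU: "r > 0" "openin Y U" "snd p \<in> U"
        "{q \<in> XS. star_dist d p q < r \<and> snd q \<in> U} \<subseteq> W"
        using map_topology_nbhd_base[OF W(2,1) star_map_in] by (auto simp: star_map_def)
      \<comment> \<open>The representing filter supplies both demands of a basic neighbourhood at
        once: closeness because it is Cauchy, lying over \<open>U\<close> because it is tied to
        \<open>snd p\<close>.\<close>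
      have "\<forall>\<^sub>F x in rep p. (x \<in> X \<and> fdist (rep p) (principal {x}) < r) \<and> f x \<in> U"
        using eventually_fdist_principal_less[OF cauchy_rep[OF p] rU(1)] eventually_rep[OF p rU(2,3)]
        by (rule eventually_conj)
      then obtain x where "x \<in> X" "fdist (rep p) (principal {x}) < r" "f x \<in> U"
        using eventually_exists[OF cauchy_rep[OF p]] by blast
      moreover have "snd (emb x) = f x" by (simp add: star_embed_def)
      ultimately have "emb x \<in> W"
        using rU(4) star_dist_embed[OF p \<open>x \<in> X\<close>] embed_in_XS[OF \<open>x \<in> X\<close>] by auto
      then show ?thesis using \<open>x \<in> X\<close> by blast
    qed
    then show "p \<in> TS closure_of (emb ` X)"
      using p by (auto simp: in_closure_of topspace_map_topology)
  qed
qed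

lemma dense_isometric_embed:
  "dense_isometric_embedding Y X f d XS star_map (star_dist d) emb"
  unfolding dense_isometric_embedding_def
proof (intro conjI ballI inj_on_embed continuous_embed dense_embed star_dist_embed_embed)
  show "emb \<in> X \<rightarrow> XS" using embed_in_XS by blast
  show "star_map (emb x) = f x" for x by (simp add: star_map_def star_embed_def)
qed


section \<open>Completeness\<close>

lemma complete_star:
  assumes large: "Pow X \<lesssim> (UNIV :: 'i set)"
  shows "complete_on_map XS Y star_map (star_dist d)"
  unfolding complete_on_map_def
proof (intro ballI allI impI, elim conjE)
  fix y and F :: "(('i, 'x) net set \<times> 'y) filter"
  assume y: "y \<in> topspace Y" and ne: "F \<noteq> bot" and "F \<le> principal XS"
    and tied: "\<forall>N\<in>nbhds_in Y y. \<forall>\<^sub>F p in F. p \<in> {z \<in> XS. star_map z \<in> N}"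
    and small: "\<forall>\<epsilon>>0. \<exists>A\<subseteq>XS. (\<forall>\<^sub>F p in F. p \<in> A) \<and> diam (star_dist d) A < ennreal \<epsilon>"
  interpret S: pseudometric XS "star_dist d"
    using pseudometric_star by unfold_locales
  have in_XS: "\<forall>\<^sub>F p in F. p \<in> XS"
    using \<open>F \<le> principal XS\<close> by (simp add: le_principal)
  have small': "\<exists>A\<subseteq>XS. (\<forall>\<^sub>F p in F. p \<in> A) \<and> (\<forall>p\<in>A. \<forall>q\<in>A. fdist (rep p) (rep q) < \<epsilon>)"
    if e: "\<epsilon> > 0" for \<epsilon>
  proof -
    obtain A where A: "A \<subseteq> XS" "\<forall>\<^sub>F p in F. p \<in> A" "diam (star_dist d) A < ennreal \<epsilon>"
      using small e by blast
    have "fdist (rep p) (rep q) < \<epsilon>" if "p \<in> A" "q \<in> A" for p q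
    proof -
      have "ennreal (star_dist d p q) \<le> diam (star_dist d) A"
        unfolding diam_def using that by (intro SUP_upper2[of "(p, q)"]) auto
      then have "ennreal (star_dist d p q) < ennreal \<epsilon>" using A(3) by (rule le_less_trans)
      moreover have "p \<in> XS" "q \<in> XS" using A(1) that by auto
      \<comment> \<open>\<open>ennreal\<close> truncates negative reals to 0, so returning to a
        strict inequality of reals uses nonnegativity.\<close>
      ultimately show ?thesis
        using S.nonneg[of p q] by (simp add: ennreal_less_iff star_dist_rep)
    qed
    then show ?thesis using A by blast
  qed
  \<comment> \<open>The diagonal filter is the union, over the members A of \<open>F\<close>, of the
    intersections of all \<open>rep p\<close> with p in A. The filter axioms are inherited from
    \<open>F\<close> and from each \<open>rep p\<close>.\<close>
  define G where "G = Abs_filter (\<lambda>P. \<forall>\<^sub>F p in F. eventually P (rep p))"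
  have G: "eventually P G \<longleftrightarrow> (\<forall>\<^sub>F p in F. eventually P (rep p))" for P
    unfolding G_def
  proof (rule eventually_Abs_filter, rule is_filter.intro)
    show "\<forall>\<^sub>F p in F. \<forall>\<^sub>F x in rep p. True" by simp
    show "\<forall>\<^sub>F p in F. \<forall>\<^sub>F x in rep p. P x \<and> Q x"
      if "\<forall>\<^sub>F p in F. eventually P (rep p)" "\<forall>\<^sub>F p in F. eventually Q (rep p)" for P Q
      using that by eventually_elim (rule eventually_conj)
    show "\<forall>\<^sub>F p in F. eventually Q (rep p)"
      if "\<forall>x. P x \<longrightarrow> Q x" "\<forall>\<^sub>F p in F. eventually P (rep p)" for P Q
      using that(2) by eventually_elim (use that(1) in \<open>auto elim: eventually_mono\<close>)
  qed
  \<comment> \<open>Every member of \<open>F\<close> leaves a trace in \<open>G\<close>: the points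
    of \<open>X\<close> within e of that member.\<close>
  have near: "\<forall>\<^sub>F x in G. x \<in> X \<and> (\<exists>p\<in>A. fdist (rep p) (principal {x}) < e)"
    if A: "A \<subseteq> XS" "\<forall>\<^sub>F p in F. p \<in> A" and e: "e > 0" for A e
    unfolding G
  proof (rule eventually_mono[OF A(2)])
    fix p assume p: "p \<in> A"
    then have "\<forall>\<^sub>F x in rep p. x \<in> X \<and> fdist (rep p) (principal {x}) < e"
      using A(1) by (intro eventually_fdist_principal_less[OF cauchy_rep e]) blast
    then show "\<forall>\<^sub>F x in rep p. x \<in> X \<and> (\<exists>p\<in>A. fdist (rep p) (principal {x}) < e)"
      by (rule eventually_mono) (use p in blast)
  qed
  have G_ne: "G \<noteq> bot"
  proof
    assume "G = bot"
    then have "\<forall>\<^sub>F p in F. eventually (\<lambda>_. False) (rep p)" using G[of "\<lambda>_. False"] by simp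
    with in_XS have "\<forall>\<^sub>F p in F. False"
      by eventually_elim (use cauchy_rep in \<open>auto simp: cauchy_def\<close>)
    then show False using ne by simp
  qed
  have G_X: "\<forall>\<^sub>F x in G. x \<in> X"
    using near[OF subset_refl in_XS, of 1] by (auto elim: eventually_mono)
  \<comment> \<open>One e leads from x to some q in A, another from q to the given p in A.\<close>
  have close: "fdist (principal {x}) (rep p) < 2 * e"
    if A: "A \<subseteq> XS" "\<forall>p\<in>A. \<forall>q\<in>A. fdist (rep p) (rep q) < e" and p: "p \<in> A" and x: "x \<in> X"
      "\<exists>q\<in>A. fdist (rep q) (principal {x}) < e" for A e p x
  proof -
    obtain q where q: "q \<in> A" "fdist (rep q) (principal {x}) < e" using x by blast
    have c: "cauchy (rep p)" "cauchy (rep q)" "cauchy (principal {x})"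
      using A p q x by (auto intro: cauchy_rep cauchy_principal)
    have "fdist (rep q) (rep p) < e" using A p q by blast
    then show ?thesis
      using fdist_triangle[OF c(3,2,1)] fdist_sym[OF c(2,3)] q(2) by linarith
  qed
  have "cauchy G"
    unfolding cauchy_def
  proof (intro conjI G_ne G_X allI impI)
    fix \<epsilon> :: real assume "\<epsilon> > 0"
    \<comment> \<open>Two points of \<open>X\<close> are compared through one p in A; each is within
      twice \<epsilon>/4 of it.\<close>
    then have e: "\<epsilon> / 4 > 0" by simp
    obtain A where A: "A \<subseteq> XS" "\<forall>\<^sub>F p in F. p \<in> A" "\<forall>p\<in>A. \<forall>q\<in>A. fdist (rep p) (rep q) < \<epsilon> / 4"
      using small'[OF e] by blast
    obtain p where p: "p \<in> A" using A(2) ne eventually_happens by blast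
    have "d x x' < \<epsilon>" if x: "x \<in> X" "\<exists>p\<in>A. fdist (rep p) (principal {x}) < \<epsilon> / 4"
      and x': "x' \<in> X" "\<exists>p\<in>A. fdist (rep p) (principal {x'}) < \<epsilon> / 4" for x x'
    proof -
      have c: "cauchy (rep p)" "cauchy (principal {x})" "cauchy (principal {x'})"
        using p A x x' by (auto intro: cauchy_rep cauchy_principal)
      show ?thesis
        using close[OF A(1,3) p x] close[OF A(1,3) p x'] fdist_triangle[OF c(2,1,3)]
          fdist_sym[OF c(3,1)] fdist_principal[OF x(1) x'(1)] by linarith
    qed
    then show "\<exists>P. eventually P G \<and> (\<forall>x y. P x \<longrightarrow> P y \<longrightarrow> d x y < \<epsilon>)"
      using near[OF A(1,2) e] by blast
  qed
  have G_tied: "\<forall>\<^sub>F x in G. f x \<in> U" if U: "openin Y U" "y \<in> U" for U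
  proof -
    have "U \<in> nbhds_in Y y" using U openin_subset by (auto simp: nbhds_in_def)
    then have "\<forall>\<^sub>F p in F. p \<in> {z \<in> XS. star_map z \<in> U}" using tied by blast
    then show ?thesis
      unfolding G by (rule eventually_mono) (auto simp: star_map_def eventually_rep[OF _ U(1)])
  qed
  \<comment> \<open>This net is indexed by pointed subsets of \<open>X\<close>; the bound
    \<open>large\<close> then gives an equivalent net indexed in \<open>'i\<close>, whose class is a
    point of the space.\<close>
  obtain \<Psi> :: "('x \<times> 'x set, 'x) net" where \<Psi>: "net_in X \<Psi>" "net_filter \<Psi> = G"
    using ex_net_with_filter[OF G_ne G_X] by blast
  have "cauchy_net_tied X Y f d y \<Psi>"
    using \<Psi> \<open>cauchy G\<close> G_tied by (simp add: cauchy_net_tied_iff)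
  from cauchy_net_tied_reindex[OF large this]
  obtain \<Phi> :: "('i, 'x) net" where "cauchy_net_tied X Y f d y \<Phi>" and eq: "net_equiv d \<Psi> \<Phi>"
    by blast
  then have \<Phi>: "\<Phi> \<in> CN y" by (simp add: cauchy_nets_def)
  define z where "z = (NC y \<Phi>, y)"
  have z: "z \<in> XS" unfolding z_def using \<Phi> y by (rule net_class_in_XS)
  have "fdist G (net_filter \<Phi>) = 0"
    using net_equiv_iff_fdist[OF \<Psi>(1) CN_D(1)[OF \<Phi>]] eq \<Psi>(2) \<open>cauchy G\<close> CN_D(2)[OF \<Phi>] by simp
  moreover have "fdist (net_filter \<Phi>) (rep z) = 0"
    unfolding z_def using \<Phi> y by (rule fdist_rep_net_class)
  ultimately have Gz: "fdist G (rep z) = 0"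
    using fdist_triangle[OF \<open>cauchy G\<close> CN_D(2)[OF \<Phi>] cauchy_rep[OF z]]
      fdist_nonneg[OF \<open>cauchy G\<close> cauchy_rep[OF z]] by linarith
  have "cluster_point_of TS F z"
    unfolding cluster_point_of_def topspace_map_topology
  proof (intro conjI z allI impI, elim conjE)
    fix W B assume W: "openin TS W" "z \<in> W"
      and B: "\<forall>\<^sub>F p in F. p \<in> B"
    obtain r U where rU: "r > 0" "openin Y U" "y \<in> U"
      "{q \<in> XS. star_dist d z q < r \<and> snd q \<in> U} \<subseteq> W"
      using map_topology_nbhd_base[OF W star_map_in] by (auto simp: star_map_def z_def)
    \<comment> \<open>The path from z to p costs 0 up to \<open>G\<close>, then less than r/4 to a
      point x of \<open>X\<close>, then less than 2r/4 by \<open>close\<close>: in all less than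
      3r/4. The estimate works for every p in A over \<open>U\<close>, so \<open>F\<close> even
      converges to z; meeting \<open>B\<close> is what a cluster point requires.\<close>
    from rU(1) have e: "r / 4 > 0" by simp
    obtain A where A: "A \<subseteq> XS" "\<forall>\<^sub>F p in F. p \<in> A" "\<forall>p\<in>A. \<forall>q\<in>A. fdist (rep p) (rep q) < r / 4"
      using small'[OF e] by blast
    have "U \<in> nbhds_in Y y" using rU openin_subset by (auto simp: nbhds_in_def)
    then have "\<forall>\<^sub>F p in F. p \<in> {z \<in> XS. star_map z \<in> U}" using tied by blast
    with A(2) B have "\<forall>\<^sub>F p in F. p \<in> A \<and> p \<in> B \<and> snd p \<in> U"
      by eventually_elim (simp add: star_map_def)
    then obtain p where p: "p \<in> A" "p \<in> B" "snd p \<in> U"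
      using ne eventually_happens by blast
    have "\<forall>\<^sub>F x in G. (x \<in> X \<and> fdist G (principal {x}) < r / 4) \<and>
        (x \<in> X \<and> (\<exists>p\<in>A. fdist (rep p) (principal {x}) < r / 4))"
      using eventually_fdist_principal_less[OF \<open>cauchy G\<close> e] near[OF A(1,2) e]
      by (rule eventually_conj)
    then obtain x where x: "x \<in> X" "fdist G (principal {x}) < r / 4"
      "\<exists>p\<in>A. fdist (rep p) (principal {x}) < r / 4"
      using eventually_exists[OF \<open>cauchy G\<close>] by blast
    have c: "cauchy (rep z)" "cauchy (rep p)" "cauchy (principal {x})"
      using z p A x by (auto intro: cauchy_rep cauchy_principal)
    have "fdist (rep z) (rep p) < r"
      using close[OF A(1,3) p(1) x(1,3)] x(2) Gz fdist_sym[OF \<open>cauchy G\<close> c(1)] rU(1)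
        fdist_triangle[OF c(1) \<open>cauchy G\<close> c(2)] fdist_triangle[OF \<open>cauchy G\<close> c(3,2)] by linarith
    moreover have "p \<in> XS" using p A(1) by blast
    ultimately have "p \<in> W"
      using rU(4) p(3) star_dist_rep[OF z, of p] by auto
    then show "W \<inter> B \<noteq> {}" using p by blast
  qed
  then show "\<exists>z\<in>fibre XS star_map y. cluster_point_of TS F z"
    using z by (intro bexI[of _ z]) (auto simp: fibre_def star_map_def z_def)
qed

end

theorem mainTheorem2:
  fixes X :: "'x set" and Y :: "'y topology" and f :: "'x \<Rightarrow> 'y" and d :: "'x \<Rightarrow> 'x \<Rightarrow> real"
    and o\<^sub>0 :: 'i
    and C :: "'y \<Rightarrow> ('i, 'x) net set"
    and X' :: "(('i, 'x) net set \<times> 'y) set"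
    and d' :: "('i, 'x) net set \<times> 'y \<Rightarrow> ('i, 'x) net set \<times> 'y \<Rightarrow> real"
    and f' :: "('i, 'x) net set \<times> 'y \<Rightarrow> 'y"
    and i :: "'x \<Rightarrow> ('i, 'x) net set \<times> 'y"
  assumes f: "f \<in> X \<rightarrow> topspace Y"
    and d: "metric_on_map X Y f d"
    and large: "Pow X \<lesssim> (UNIV :: 'i set)"
  defines "C \<equiv> cauchy_nets X Y f d"
    and "X' \<equiv> star_space X Y f d"
    and "d' \<equiv> star_dist d"
    and "f' \<equiv> star_map"
    and "i \<equiv> star_embed o\<^sub>0 X Y f d"
  shows "(\<forall>y\<in>topspace Y. equiv (C y) (net_rel X Y f d y)) \<and>
    (\<forall>y\<in>topspace Y. \<forall>y'\<in>topspace Y. \<forall>\<Phi>\<in>C y. \<forall>\<Phi>'\<in>C y'.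
      net_dist_tendsto d \<Phi> \<Phi>' (d' (net_class X Y f d y \<Phi>, y) (net_class X Y f d y' \<Phi>', y'))) \<and>
    metric_on_map X' Y f' d' \<and>
    complete_on_map X' Y f' d' \<and>
    dense_isometric_embedding Y X f d X' f' d' i \<and>
    is_completion Y X f d X' f' d' i"
proof -
  interpret metric_map X d Y f o\<^sub>0
    using f d by unfold_locales (auto simp: metric_on_map_def)
  \<comment> \<open>Convergence to one value for arbitrary representatives of the two classes is the
    well-definedness of the distance.\<close>
  have "net_dist_tendsto d \<Phi> \<Phi>' (star_dist d (NC y \<Phi>, y) (NC y' \<Phi>', y'))"
    if "y \<in> topspace Y" "y' \<in> topspace Y" "\<Phi> \<in> CN y" "\<Phi>' \<in> CN y'"
    for y y' and \<Phi> \<Phi>' :: "('i, 'x) net"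
    using that star_dist_eq[OF net_class_in_XS _ net_class_in_XS, of \<Phi> y \<Phi> \<Phi>' y' \<Phi>']
    by (simp add: net_dist_tendsto_iff_fdist self_in_net_class)
  then show ?thesis
    unfolding C_def X'_def d'_def f'_def i_def is_completion_def complete_metric_mapping_def
      metric_mapping_def
    using equiv_net_rel metric_star complete_star[OF large] dense_isometric_embed star_map_in by blast
qed

end
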